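(* Let $M$ be an $\omega$-bounded surface which is Schoenflies (equivalently, simply connected). Then every flow $f\colon \mathbb{R}\times M\to M$ has a fixed point, i.e. there is $x\in M$ with $f(t,x)=x$ for all $t\in\mathbb{R}$.
   Context: A surface is a connected Hausdorff topological $2$-manifold without boundary, not assumed metrizable. A space is $\omega$-bounded if every countable subset has compact closure. A surface is Schoenflies if every subset homeomorphic to the circle bounds a (closed, embedded) $2$-disc; for surfaces this is equivalent to simple connectivity. A flow on a space $X$ is a continuous action $f\colon\mathbb{R}\times X\to X$ of the additive group $\mathbb{R}$. *)

theory Defs
  imports "HOL-Analysis.Analysis"
begin

text \<open>
  A space is represented by a type of class \<^class>\<open>topological_space\<close>; the Hausdorff condition is
  the class \<^class>\<open>t2_space\<close>. No metrizability or countability class is ever required, and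
  nonemptiness comes from HOL types being inhabited.
\<close>

definition surface :: "'a::t2_space itself \<Rightarrow> bool" where
  "surface _ \<longleftrightarrow>
     connected (UNIV :: 'a set) \<and>
     (\<forall>x::'a. \<exists>U (V :: (real ^ 2) set). open U \<and> x \<in> U \<and> open V \<and> U homeomorphic V)"

definition omega_bounded :: "'a::topological_space itself \<Rightarrow> bool" where
  "omega_bounded _ \<longleftrightarrow> (\<forall>A :: 'a set. countable A \<longrightarrow> compact (closure A))"

text \<open>
  A set \<open>C\<close> bounds a disc if it is the boundary circle of an embedded closed disc \<open>D\<close>, meaning
  that some homeomorphism from the closed unit disc onto \<open>D\<close> maps the unit circle onto \<open>C\<close>. The
  boundary of \<open>D\<close> is thus taken in the sense of manifolds with boundary; \<open>D\<close> is compact, hence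
  automatically closed in a Hausdorff space.
\<close>

definition bounds_disc :: "'a::topological_space set \<Rightarrow> bool" where
  "bounds_disc C \<longleftrightarrow>
     (\<exists>D h k. homeomorphism (cball (0 :: real ^ 2) 1) D h k \<and> h ` sphere 0 1 = C)"

definition Schoenflies :: "'a::topological_space itself \<Rightarrow> bool" where
  "Schoenflies _ \<longleftrightarrow>
     (\<forall>C :: 'a set. C homeomorphic sphere (0 :: real ^ 2) 1 \<longrightarrow> bounds_disc C)"

definition flow :: "(real \<times> 'a::topological_space \<Rightarrow> 'a) \<Rightarrow> bool" where
  "flow f \<longleftrightarrow>
     continuous_on UNIV f \<and>
     (\<forall>x. f (0, x) = x) \<and>
     (\<forall>s t x. f (s + t, x) = f (s, f (t, x)))"

end

theory Submission imports Defs begin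

text \<open>
  Suppose the flow has no fixed point. If \<open>C\<close> is the boundary circle of a disc \<open>D\<close>, then for small
  \<open>\<delta> > 0\<close> the map \<open>f (\<delta>, _)\<close> has no fixed point on \<open>D\<close>, so the displacement \<open>y \<mapsto> f (\<delta>, y) - y\<close>, read
  off in a map to the plane that extends a coordinate of \<open>D\<close>, has index 0 along \<open>C\<close>. If on the other
  hand \<open>C\<close> contains no point of period at most \<open>\<epsilon>\<close> and \<open>f (\<epsilon>, _)\<close> is homotopic on \<open>C\<close>, through maps
  moving every point and with values in the union of \<open>C\<close> and a compact set not containing \<open>C\<close>, to a
  fixed-point-free map of \<open>C\<close> into itself, then this index is 1, as for
  \<open>y \<mapsto> - y\<close> on the unit circle. So no such \<open>C\<close> exists.

  A periodic orbit is such a circle. Without periodic orbits, let \<open>x0\<close> be an \<open>\<omega>\<close>-limit point, which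
  exists by \<open>\<omega>\<close>-boundedness. Some orbit segment starts and ends near \<open>x0\<close>; a suitable subsegment
  together with a short straight segment in a chart is a circle \<open>C\<close>, on which \<open>f (\<epsilon>, _)\<close> is close to the
  rotation of \<open>C\<close> by the parameter \<open>\<epsilon>\<close>. No transversal to the flow is needed.
\<close>

section \<open>Compact Hausdorff spaces and invariance of domain\<close>

lemma normal_space_compact_t2:
  fixes X :: "'a::t2_space set"
  assumes "compact X"
  shows "normal_space (top_of_set X)"
proof -
  have "Hausdorff_space (euclidean :: 'a topology)"
    unfolding Hausdorff_space_def by (simp add: disjnt_def) (meson hausdorff)
  then show ?thesis
    by (simp add: Hausdorff_space_subtopology assms compact_Hausdorff_or_regular_imp_normal_space
      compact_space_subtopology)
qed

text \<open>Compact Hausdorff spaces are normal, so Tietze's theorem applies to each coordinate;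
  working on compact sets in this way takes the place of metrizability.\<close>

lemma Tietze_extension_compact:
  fixes f :: "'a::t2_space \<Rightarrow> 'b::euclidean_space"
  assumes "compact X" "closed A" "A \<subseteq> X" "continuous_on A f"
  obtains g where "continuous_on X g" "\<And>x. x \<in> A \<Longrightarrow> g x = f x"
proof -
  have "\<exists>g. continuous_on X g \<and> (\<forall>x\<in>A. g x = f x \<bullet> i)" for i
  proof -
    have "closedin (top_of_set X) A"
      using assms by (simp add: closed_subset)
    moreover have "continuous_map (subtopology (top_of_set X) A) euclideanreal (\<lambda>x. f x \<bullet> i)"
      using assms by (auto simp: subtopology_subtopology Int_absorb1 intro!: continuous_intros)
    ultimately obtain g where "continuous_map (top_of_set X) euclideanreal g"
      "\<And>x. x \<in> A \<Longrightarrow> g x = f x \<bullet> i"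
      by (rule Tietze_extension_realinterval[OF normal_space_compact_t2[OF assms(1)] _ is_interval_univ UNIV_not_empty]) auto
    then show ?thesis by auto
  qed
  then obtain g where g: "\<And>i. continuous_on X (g i)" "\<And>i x. x \<in> A \<Longrightarrow> g i x = f x \<bullet> i"
    by metis
  show ?thesis
  proof
    show "continuous_on X (\<lambda>x. \<Sum>i\<in>Basis. g i x *\<^sub>R i)"
      by (intro continuous_intros g)
    show "(\<Sum>i\<in>Basis. g i x *\<^sub>R i) = f x" if "x \<in> A" for x
      using g(2)[OF that] by (simp add: euclidean_representation)
  qed
qed

lemma Urysohn_compact:
  fixes X :: "'a::t2_space set"
  assumes "compact X" "closed A" "A \<subseteq> X" "closed B" "B \<subseteq> X" "A \<inter> B = {}"
  obtains g :: "'a \<Rightarrow> real" where "continuous_on X g" "\<And>x. x \<in> X \<Longrightarrow> 0 \<le> g x \<and> g x \<le> 1"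
    "\<And>x. x \<in> A \<Longrightarrow> g x = 0" "\<And>x. x \<in> B \<Longrightarrow> g x = 1"
proof -
  have "closedin (top_of_set X) A" "closedin (top_of_set X) B" "disjnt A B"
    using assms by (simp_all add: closed_subset disjnt_def)
  then obtain g where "continuous_map (top_of_set X) (top_of_set {0..1::real}) g"
    "g ` A \<subseteq> {0}" "g ` B \<subseteq> {1}"
    using Urysohn_lemma[OF normal_space_compact_t2[OF assms(1)], of A B 0 1] by auto
  then show ?thesis
    by (intro that[of g]) (auto simp: continuous_map_in_subtopology image_subset_iff)
qed

text \<open>A continuous map from a compact set to a Hausdorff space is closed, hence a quotient map
  onto its image. This later carries a homotopy from a parameter interval down to a circle.\<close>

lemma continuous_on_quotient_compact:
  fixes p :: "'a::t2_space \<Rightarrow> 'b::t2_space" and g :: "'b \<Rightarrow> 'c::topological_space"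
  assumes "compact K" "continuous_on K p" "continuous_on K (\<lambda>x. g (p x))"
  shows "continuous_on (p ` K) g"
  unfolding continuous_on_closed_vimage[OF compact_imp_closed[OF compact_continuous_image[OF assms(2,1)]]]
proof (intro allI impI)
  fix B :: "'c set" assume "closed B"
  then have "closed ((\<lambda>x. g (p x)) -` B \<inter> K)"
    using assms(1,3) by (simp add: continuous_on_closed_vimage compact_imp_closed)
  then have "compact (K \<inter> ((\<lambda>x. g (p x)) -` B \<inter> K))"
    using assms(1) by blast
  then have "compact (p ` (K \<inter> ((\<lambda>x. g (p x)) -` B \<inter> K)))"
    by (rule compact_continuous_image[OF continuous_on_subset[OF assms(2)], rotated]) auto
  moreover have "g -` B \<inter> p ` K = p ` (K \<inter> ((\<lambda>x. g (p x)) -` B \<inter> K))" by auto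
  ultimately show "closed (g -` B \<inter> p ` K)" by (simp add: compact_imp_closed)
qed

text \<open>Reading \<open>h\<close> in a chart around each image point reduces this to invariance
  of domain in the plane. It serves to show that the interior of an embedded disc is open in the
  surface.\<close>

lemma surface_invariance_of_domain:
  fixes h :: "real ^ 2 \<Rightarrow> 'a::t2_space"
  assumes "surface TYPE('a)" "open S" "continuous_on S h" "inj_on h S"
  shows "open (h ` S)"
  unfolding open_subopen[of "h ` S"]
proof clarify
  fix z assume z: "z \<in> S"
  obtain U V where UV: "open U" "h z \<in> U" "open (V :: (real^2) set)" "U homeomorphic V"
    using assms(1) unfolding surface_def by meson
  then obtain \<phi> \<psi> where hom: "homeomorphism U V \<phi> \<psi>"
    unfolding homeomorphic_def by auto
  define S' where "S' = S \<inter> h -` U"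
  have S': "open S'" "S' \<subseteq> S" "z \<in> S'" "h ` S' \<subseteq> U"
    using assms UV z continuous_on_open_vimage[OF assms(2), of h]
    unfolding S'_def by (auto simp: Int_commute)
  have "continuous_on S' (\<lambda>x. \<phi> (h x))"
    by (rule continuous_on_compose2[OF homeomorphism_cont1[OF hom] continuous_on_subset[OF assms(3) S'(2)] S'(4)])
  moreover have "inj_on (\<lambda>x. \<phi> (h x)) S'"
    unfolding inj_on_def using assms(4) S' homeomorphism_apply1[OF hom]
    by (metis image_subset_iff inj_onD subsetD)
  ultimately have "open ((\<lambda>x. \<phi> (h x)) ` S')"
    using S'(1) invariance_of_domain by blast
  then have "open ((\<lambda>x. \<phi> (h x)) ` S' \<inter> V)" using UV by blast
  moreover have "(\<lambda>x. \<phi> (h x)) ` S' \<subseteq> V" using S'(4) hom by (auto simp: homeomorphism_def)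
  ultimately have "openin (top_of_set V) ((\<lambda>x. \<phi> (h x)) ` S')"
    using UV(3) by (simp add: openin_open_eq Int_absorb2)
  then have "openin (top_of_set U) (\<psi> ` ((\<lambda>x. \<phi> (h x)) ` S'))"
    using hom homeomorphism_imp_open_map homeomorphism_symD by blast
  moreover have "\<psi> ` ((\<lambda>x. \<phi> (h x)) ` S') = h ` S'"
    unfolding image_image using S'(4) homeomorphism_apply1[OF hom] by (intro image_cong) auto
  ultimately have "open (h ` S')" using UV(1) openin_open_trans by force
  then show "\<exists>T. open T \<and> h z \<in> T \<and> T \<subseteq> h ` S" using S' by blast
qed

section \<open>Flows and their periods\<close>

lemma flow_add: "flow f \<Longrightarrow> f (s, f (t, x)) = f (s + t, x)"
  by (simp add: flow_def)

lemma flow_zero [simp]: "flow f \<Longrightarrow> f (0, x) = x"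
  by (simp add: flow_def)

lemma continuous_on_flow:
  assumes "flow f" "continuous_on S a" "continuous_on S b"
  shows "continuous_on S (\<lambda>x. f (a x, b x))"
  by (rule continuous_on_compose2[of UNIV f S "\<lambda>x. (a x, b x)"])
    (use assms in \<open>auto simp: flow_def intro!: continuous_intros\<close>)

lemma flow_periodic_multiple:
  assumes "flow f" "f (d, y) = y"
  shows "f (of_int n * d, y) = y"
proof -
  have nat: "f (of_nat n * d, y) = y" for n
  proof (induction n)
    case (Suc n)
    then show ?case using flow_add[OF assms(1), of d "of_nat n * d" y] assms(2)
      by (simp add: algebra_simps)
  qed (simp add: assms(1))
  show ?thesis
  proof (cases "n \<ge> 0")
    case True
    then show ?thesis using nat[of "nat n"] by simp
  next
    case False
    then have "f (of_int n * d, f (of_nat (nat (- n)) * d, y)) = y"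
      by (simp add: flow_add[OF assms(1)] assms(1))
    then show ?thesis using nat by simp
  qed
qed

text \<open>A limit of points with period tending to 0 is stationary.\<close>

lemma flow_fixed_point_of_small_periods:
  fixes f :: "real \<times> 'a::t2_space \<Rightarrow> 'a" and h :: "'b::metric_space \<Rightarrow> 'a"
  assumes f: "flow f" and B: "compact B" "continuous_on B h"
    and small: "\<And>d. d > 0 \<Longrightarrow> \<exists>e z. 0 < e \<and> e < d \<and> z \<in> B \<and> f (e, h z) = h z"
  shows "\<exists>x. \<forall>t. f (t, x) = x"
proof -
  have "\<forall>n. \<exists>e z. 0 < e \<and> e < inverse (real (Suc n)) \<and> z \<in> B \<and> f (e, h z) = h z"
    using small by simp
  then obtain e z where ez: "\<And>n. 0 < e n" "\<And>n. e n < inverse (real (Suc n))"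
    "\<And>n. z n \<in> B" "\<And>n. f (e n, h (z n)) = h (z n)"
    by metis
  obtain l r where lr: "l \<in> B" "strict_mono r" "(z \<circ> r) \<longlonglongrightarrow> l"
    using B(1) ez(3) unfolding compact_def by metis
  have hl: "(\<lambda>n. h (z (r n))) \<longlonglongrightarrow> h l"
    using B(2) lr ez(3) by (auto simp: continuous_on_sequentially comp_def)
  have e0: "(\<lambda>n. e (r n)) \<longlonglongrightarrow> 0"
  proof (rule tendsto_sandwich[of "\<lambda>_. 0" _ _ "\<lambda>n. inverse (real (Suc n))"])
    have "e (r n) \<le> inverse (real (Suc n))" for n
    proof -
      have "n \<le> r n" using lr(2) by (simp add: seq_suble)
      then have "inverse (real (Suc (r n))) \<le> inverse (real (Suc n))"
        by (intro le_imp_inverse_le) auto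
      with ez(2)[of "r n"] show ?thesis by linarith
    qed
    then show "\<forall>\<^sub>F n in sequentially. e (r n) \<le> inverse (real (Suc n))" by simp
  next
    show "(\<lambda>n. inverse (real (Suc n))) \<longlonglongrightarrow> 0" by (rule LIMSEQ_inverse_real_of_nat)
  qed (use ez(1) in \<open>auto intro!: always_eventually less_imp_le\<close>)
  have "f (t, h l) = h l" for t
  proof -
    \<comment> \<open>The multiple of the period \<open>e (r n)\<close> just below \<open>t\<close>
      is within \<open>e (r n)\<close> of \<open>t\<close>. These times tend to \<open>t\<close>,
      and flowing \<open>h (z (r n))\<close> for them changes nothing.\<close>
    define k where "k n = \<lfloor>t / e (r n)\<rfloor>" for n
    have "(\<lambda>n. of_int (k n) * e (r n)) \<longlonglongrightarrow> t"
    proof (rule LIM_zero_cancel, rule Lim_null_comparison[OF _ e0], intro always_eventually allI)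
      fix n
      have "of_int (k n) \<le> t / e (r n)" "t / e (r n) < of_int (k n) + 1"
        unfolding k_def by linarith+
      then have "of_int (k n) * e (r n) \<le> t" "t < (of_int (k n) + 1) * e (r n)"
        using ez(1)[of "r n"] by (simp_all add: field_simps)
      then show "norm (of_int (k n) * e (r n) - t) \<le> e (r n)"
        by (simp add: algebra_simps)
    qed
    then have "(\<lambda>n. (of_int (k n) * e (r n), h (z (r n)))) \<longlonglongrightarrow> (t, h l)"
      using hl by (rule tendsto_Pair)
    then have "(\<lambda>n. f (of_int (k n) * e (r n), h (z (r n)))) \<longlonglongrightarrow> f (t, h l)"
      using f unfolding flow_def by (intro continuous_on_tendsto_compose[of UNIV f]) auto
    then show ?thesis
      using flow_periodic_multiple[OF f ez(4)] hl LIMSEQ_unique by auto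
  qed
  then show ?thesis by blast
qed

section \<open>Extending the disc coordinate and the displacement\<close>

text \<open>A circle minus a point is a line, so \<open>g\<close> becomes a real function and
  Tietze's theorem extends it without creating values off the circle.\<close>

lemma circle_map_extension:
  fixes g :: "'a::t2_space \<Rightarrow> real ^ 2"
  assumes "compact V" "closed A" "A \<subseteq> V" "continuous_on A g"
    and e: "e \<in> sphere 0 1" and g: "g ` A \<subseteq> sphere 0 1 - {e}"
  obtains g' where "continuous_on V g'" "g' ` V \<subseteq> sphere 0 1" "\<And>x. x \<in> A \<Longrightarrow> g' x = g x"
proof -
  have "(sphere (0 :: real^2) 1 - {e}) homeomorphic (UNIV :: real set)"
    using e by (intro homeomorphic_punctured_sphere_affine) auto
  then obtain \<omega> \<omega>' where hom: "homeomorphism (sphere 0 1 - {e}) (UNIV :: real set) \<omega> \<omega>'"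
    unfolding homeomorphic_def by blast
  have "continuous_on A (\<lambda>x. \<omega> (g x))"
    by (rule continuous_on_compose2[OF homeomorphism_cont1[OF hom] assms(4) g])
  then obtain G where G: "continuous_on V G" "\<And>x. x \<in> A \<Longrightarrow> G x = \<omega> (g x)"
    using Tietze_extension_compact[OF assms(1-3)] by metis
  show ?thesis
  proof
    show "continuous_on V (\<lambda>x. \<omega>' (G x))"
      by (rule continuous_on_compose2[OF homeomorphism_cont2[OF hom] G(1)]) auto
    show "(\<lambda>x. \<omega>' (G x)) ` V \<subseteq> sphere 0 1"
      using homeomorphism_image2[OF hom] by blast
    show "\<omega>' (G x) = g x" if "x \<in> A" for x
      using G(2)[OF that] homeomorphism_apply1[OF hom, of "g x"] that g by (metis image_subset_iff)
  qed
qed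

lemma homotopic_with_canonI:
  assumes "continuous_on ({0..1::real} \<times> S) H" "H ` ({0..1} \<times> S) \<subseteq> T"
    "\<And>x. x \<in> S \<Longrightarrow> H (0, x) = p x" "\<And>x. x \<in> S \<Longrightarrow> H (1, x) = q x"
  shows "homotopic_with_canon (\<lambda>_. True) S T p q"
proof (subst homotopic_with)
  show "\<exists>h. continuous_map (prod_topology (top_of_set {0..1::real}) (top_of_set S)) (top_of_set T) h \<and>
      (\<forall>x\<in>topspace (top_of_set S). h (0, x) = p x) \<and> (\<forall>x\<in>topspace (top_of_set S). h (1, x) = q x) \<and>
      (\<forall>t\<in>{0..1::real}. True)"
    by (rule exI[of _ H]) (use assms in \<open>simp add: image_subset_iff_funcset\<close>)
qed simp

text \<open>
  \<open>W (y, z)\<close> plays the role of \<open>z - y\<close> when \<open>z\<close> may lie outside the disc. The factor \<open>1 - \<kappa>\<close> in the proof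
  shrinks \<open>y\<close> off the unit circle when \<open>r\<close> sends an exterior point \<open>z\<close> to the coordinate of \<open>y\<close>.
\<close>

lemma nonzero_difference_extension:
  fixes h :: "real ^ 2 \<Rightarrow> 'a::t2_space"
  assumes hom: "homeomorphism (cball 0 1) D h k"
    and U: "open (h ` ball 0 1)"
    and Y: "compact Y" "D \<subseteq> Y"
    and r: "continuous_on Y r" "\<And>z. z \<in> D \<Longrightarrow> r z = k z" "\<And>z. z \<in> Y \<Longrightarrow> z \<notin> D \<Longrightarrow> norm (r z) = 1"
    and Q: "compact Q" "Q \<subseteq> D \<times> Y" "\<And>y z. (y, z) \<in> Q \<Longrightarrow> y \<noteq> z"
  obtains W :: "'a \<times> 'a \<Rightarrow> real ^ 2" where "continuous_on Q W" "\<And>p. p \<in> Q \<Longrightarrow> W p \<noteq> 0"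
    "\<And>y z. (y, z) \<in> Q \<Longrightarrow> z \<in> D \<Longrightarrow> W (y, z) = k z - k y"
proof -
  have D: "compact D"
    using hom compact_continuous_image[of "cball 0 1" h] by (auto simp: homeomorphism_def)
  have k_norm: "norm (k y) \<le> 1" if "y \<in> D" for y
    using hom that by (auto simp: homeomorphism_def)
  have k_inj: "y = z" if "k y = k z" "y \<in> D" "z \<in> D" for y z
    using hom that by (metis homeomorphism_apply2)
  have r_snd: "continuous_on Q (\<lambda>p. r (snd p))"
    by (rule continuous_on_compose2[OF r(1)]) (use Q in \<open>auto intro!: continuous_intros\<close>)
  have k_fst: "continuous_on Q (\<lambda>p. k (fst p))"
    by (rule continuous_on_compose2[OF homeomorphism_cont2[OF hom]])
      (use Q in \<open>auto intro!: continuous_intros\<close>)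
  define A where "A = Q \<inter> (UNIV \<times> D)"
  \<comment> \<open>\<open>B\<close> holds the pairs at which \<open>r z - k y\<close> vanishes
    although \<open>z\<close> is not in the open disc. Excluding only the open disc, not
    \<open>D\<close>, makes \<open>B\<close> closed; a common point of \<open>A\<close> and
    \<open>B\<close> would give \<open>k z = k y\<close>, hence \<open>z = y\<close>.\<close>
  define B where "B = {p \<in> Q. r (snd p) - k (fst p) = 0} \<inter> (UNIV \<times> (- h ` ball 0 1))"
  have "closed A"
    unfolding A_def using Q(1) D by (intro closed_Int closed_Times) (auto simp: compact_imp_closed)
  moreover have "closed B"
    unfolding B_def using Q(1) U r_snd k_fst
    by (intro closed_Int closed_Times continuous_closed_preimage_constant continuous_intros)
      (auto simp: compact_imp_closed)
  moreover have "A \<inter> B = {}"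
  proof -
    have False if "(y, z) \<in> Q" "z \<in> D" "r z = k y" "z \<notin> h ` ball 0 1" for y z
      using that Q k_inj r(2) by (metis mem_Sigma_iff subsetD)
    then show ?thesis by (auto simp: A_def B_def)
  qed
  ultimately obtain \<kappa> :: "'a \<times> 'a \<Rightarrow> real" where \<kappa>: "continuous_on Q \<kappa>"
    "\<And>p. p \<in> Q \<Longrightarrow> 0 \<le> \<kappa> p \<and> \<kappa> p \<le> 1" "\<And>p. p \<in> A \<Longrightarrow> \<kappa> p = 0" "\<And>p. p \<in> B \<Longrightarrow> \<kappa> p = 1"
    using Urysohn_compact[OF Q(1), of A B] by (auto simp: A_def B_def)
  show ?thesis
  proof
    let ?W = "\<lambda>p. r (snd p) - (1 - \<kappa> p) *\<^sub>R k (fst p)"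
    show "continuous_on Q ?W"
      using r_snd k_fst \<kappa>(1) by (intro continuous_intros)
    show on_D: "?W (y, z) = k z - k y" if "(y, z) \<in> Q" "z \<in> D" for y z
      using that \<kappa>(3)[of "(y, z)"] r(2) by (simp add: A_def)
    show "?W p \<noteq> 0" if p: "p \<in> Q" for p
    proof
      assume 0: "?W p = 0"
      obtain y z where yz: "p = (y, z)" by fastforce
      have y: "y \<in> D" and z: "z \<in> Y" using p Q(2) yz by auto
      show False
      proof (cases "z \<in> D")
        case True
        then show False using on_D[of y z] 0 p yz k_inj[of z y] y Q(3)[of y z] by auto
      next
        case False
        have eq: "r z = (1 - \<kappa> p) *\<^sub>R k y" using 0 yz by simp
        \<comment> \<open>\<open>r z\<close> is a unit vector and \<open>k y\<close> has norm at
          most 1, which forces \<open>\<kappa> p = 0\<close>; but then \<open>p\<close> lies in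
          \<open>B\<close>, where \<open>\<kappa>\<close> is 1.\<close>
        then have "1 = (1 - \<kappa> p) * norm (k y)"
          using r(3)[OF z False] \<kappa>(2)[OF p] by simp
        also have "\<dots> \<le> 1 - \<kappa> p"
          using mult_left_mono[OF k_norm[OF y], of "1 - \<kappa> p"] \<kappa>(2)[OF p] by simp
        finally have "\<kappa> p = 0" using \<kappa>(2)[OF p] by simp
        moreover have "p \<in> B"
          using eq False p yz \<open>\<kappa> p = 0\<close> hom by (auto simp: B_def homeomorphism_def)
        ultimately show False using \<kappa>(4) by fastforce
      qed
    qed
  qed
qed

text \<open>
  Since \<open>V\<close> misses a point of the boundary circle, the coordinate on the part of that circle in \<open>V\<close>
  takes values in an arc, so it extends over \<open>V\<close> however the disc winds around in \<open>V\<close>.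
\<close>

lemma disc_coordinate_extension:
  fixes h :: "real ^ 2 \<Rightarrow> 'a::t2_space"
  assumes hom: "homeomorphism (cball 0 1) D h k"
    and op: "open (h ` ball 0 1)"
    and V: "compact V" "\<not> h ` sphere 0 1 \<subseteq> V"
    and X: "compact X" "D \<union> V \<subseteq> X"
  obtains Z r where "closed Z" "Z \<inter> (D \<union> V) = {}" "continuous_on (X - Z) r"
    "\<And>z. z \<in> D \<Longrightarrow> r z = k z" "\<And>z. z \<in> X - Z \<Longrightarrow> z \<notin> D \<Longrightarrow> norm (r z) = 1"
proof -
  define C where "C = h ` sphere 0 1"
  define U where "U = h ` ball 0 1"
  have oU: "open U" using op by (simp add: U_def)
  have conth: "continuous_on (cball 0 1) h" and D_eq: "D = h ` cball 0 1"
    and contk: "continuous_on D k"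
    using homeomorphism_cont1[OF hom] homeomorphism_image1[OF hom] homeomorphism_cont2[OF hom] by simp_all
  have D: "compact D" using compact_continuous_image[OF conth] D_eq by simp
  have C: "compact C" unfolding C_def
    by (intro compact_continuous_image continuous_on_subset[OF conth]) auto
  have CD: "C \<subseteq> D" by (auto simp: C_def D_eq)
  have kC: "k y \<in> sphere 0 1" if "y \<in> C" for y
    using that hom by (auto simp: C_def homeomorphism_def)
  have CU: "C \<inter> U = {}"
  proof -
    have False if "y \<in> C" "y \<in> U" for y
    proof -
      have "norm (k y) < 1" using that(2) hom by (auto simp: U_def homeomorphism_def)
      then show False using kC[OF that(1)] by simp
    qed
    then show ?thesis by blast
  qed
  have DU: "D - U \<subseteq> C"
    by (auto simp: D_eq U_def C_def) (metis image_eqI le_less mem_ball_0 mem_sphere_0)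
  obtain e' where e': "e' \<in> C" "e' \<notin> V" using V(2) by (auto simp: C_def)
  have "k ` (C \<inter> V) \<subseteq> sphere 0 1 - {k e'}"
  proof -
    have "k y \<noteq> k e'" if "y \<in> C" "y \<in> V" for y
      using that e' CD homeomorphism_apply2[OF hom] by (metis subsetD)
    then show ?thesis using kC by auto
  qed
  moreover have "continuous_on (C \<inter> V) k" using contk CD continuous_on_subset by blast
  moreover have "closed (C \<inter> V)" using C V by (simp add: compact_imp_closed closed_Int)
  ultimately obtain g where g: "continuous_on V g" "g ` V \<subseteq> sphere 0 1" "\<And>x. x \<in> C \<inter> V \<Longrightarrow> g x = k x"
    using circle_map_extension[OF V(1), of "C \<inter> V" k "k e'"] kC[OF e'(1)] by (metis Int_lower2)
  define A where "A = C \<union> (V - U)"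
  \<comment> \<open>On the circle the prescribed value is the disc coordinate, on \<open>V\<close>
    outside the open disc it is the extension \<open>g\<close>; both are unit vectors and agree on
    \<open>C \<inter> V\<close>.\<close>
  define u where "u z = (if z \<in> C then k z else g z)" for z
  have "continuous_on A u" unfolding A_def u_def
  proof (rule continuous_on_cases)
    show "closed C" "closed (V - U)" using C V(1) oU by (auto simp: compact_imp_closed)
    show "continuous_on C k" using contk CD continuous_on_subset by blast
    show "continuous_on (V - U) g" using g(1) continuous_on_subset by blast
  qed (use g(3) in auto)
  moreover have A: "closed A" "A \<subseteq> X"
    using C V(1) oU X(2) CD by (auto simp: A_def compact_imp_closed closed_Diff)
  ultimately obtain E where E: "continuous_on X E" "\<And>x. x \<in> A \<Longrightarrow> E x = u x"
    using Tietze_extension_compact[OF X(1)] by metis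
  have E_norm: "norm (E x) = 1" if "x \<in> A" for x
    using E(2)[OF that] that kC g(2) by (auto simp: u_def A_def image_subset_iff)
  \<comment> \<open>The extension \<open>E\<close> may vanish off \<open>A\<close>. Its zeros
    outside the open disc are removed as \<open>Z\<close>; since \<open>E\<close> has norm 1 on
    \<open>A\<close>, \<open>Z\<close> meets neither \<open>D\<close> nor \<open>V\<close>, and on
    the rest of the exterior \<open>E\<close> can be normalised.\<close>
  define Z where "Z = {z \<in> X - U. E z = 0}"
  define r where "r z = (if z \<in> D then k z else E z /\<^sub>R norm (E z))" for z
  have XU: "closed (X - U)" using X(1) oU by (simp add: compact_imp_closed closed_Diff)
  show ?thesis
  proof
    show "closed Z" unfolding Z_def
      by (intro continuous_closed_preimage_constant continuous_on_subset[OF E(1)] XU) auto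
    have "z \<in> A" if "z \<in> Z" "z \<in> D \<union> V" for z
      using that DU by (auto simp: Z_def A_def)
    then show ZD: "Z \<inter> (D \<union> V) = {}" using E_norm by (force simp: Z_def)
    show "r z = k z" if "z \<in> D" for z using that by (simp add: r_def)
    show "norm (r z) = 1" if "z \<in> X - Z" "z \<notin> D" for z
      using that by (auto simp: r_def Z_def U_def D_eq)
    have eq: "X - Z = D \<union> (X - U - Z)" using X(2) ZD DU CU by (auto simp: U_def D_eq)
    show "continuous_on (X - Z) r" unfolding eq r_def
    proof (rule continuous_on_cases_local)
      show "closedin (top_of_set (D \<union> (X - U - Z))) D"
        using D by (simp add: closed_subset compact_imp_closed)
      have "X - U - Z = (X - Z) \<inter> (X - U)" by auto
      then show "closedin (top_of_set (D \<union> (X - U - Z))) (X - U - Z)"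
        unfolding eq[symmetric] using XU by (metis closedin_closed_Int)
      show "continuous_on (X - U - Z) (\<lambda>z. E z /\<^sub>R norm (E z))"
        by (intro continuous_intros continuous_on_subset[OF E(1)]) (auto simp: Z_def)
      show "k z = E z /\<^sub>R norm (E z)" if "z \<in> D \<and> z \<notin> D \<or> z \<in> X - U - Z \<and> z \<in> D" for z
      proof -
        have "z \<in> C" using that DU by blast
        then show ?thesis using E(2)[of z] E_norm[of z] by (simp add: A_def u_def)
      qed
    qed (rule contk)
  qed
qed

section \<open>The index along a boundary circle\<close>

text \<open>A null-homotopic map of the circle extends over the disc without zeros; normalising the
  extension and changing its sign would give a retraction of the disc onto its boundary.\<close>

lemma minus_id_circle_essential:
  assumes "homotopic_with_canon (\<lambda>_. True) (sphere (0 :: real^2) 1) (- {0}) (\<lambda>z. - z) (\<lambda>_. c)"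
  shows False
proof -
  obtain g :: "real^2 \<Rightarrow> real^2" where g: "continuous_on (cball 0 1) g" "g ` cball 0 1 \<subseteq> - {0}"
    "\<And>x. x \<in> sphere 0 1 \<Longrightarrow> g x = - x"
    using assms nullhomotopic_from_sphere_extension[of 0 1 "- {0}" "\<lambda>z. - z"] by metis
  have "retraction (cball 0 1) (sphere 0 1) (\<lambda>x. - (g x /\<^sub>R norm (g x)))"
    unfolding retraction_def
  proof (intro conjI ballI)
    show "continuous_on (cball 0 1) (\<lambda>x. - (g x /\<^sub>R norm (g x)))"
      using g(2) by (intro continuous_intros g(1)) auto
    have "g x \<noteq> 0" if "x \<in> cball 0 1" for x using g(2) that by blast
    then show "(\<lambda>x. - (g x /\<^sub>R norm (g x))) \<in> cball 0 1 \<rightarrow> sphere 0 1" by auto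
  qed (use g(3) in auto)
  then show False
    using no_retraction_cball[of 1 "0 :: real^2"] by (auto simp: retract_of_def)
qed

text \<open>This is the index criterion. \<open>V\<close> is the room outside \<open>C\<close> that
  images of points of \<open>C\<close> may use, and it omits a point of \<open>C\<close> so that the
  disc coordinate extends over it. \<open>J\<close> deforms \<open>f (\<epsilon>, _)\<close> to a
  fixed-point-free self-map of \<open>C\<close>.\<close>

lemma flow_fixed_point_of_loop:
  fixes h :: "real ^ 2 \<Rightarrow> 'a::t2_space"
  assumes "surface TYPE('a)" and f: "flow f"
    and hom: "homeomorphism (cball 0 1) D h k"
    and C: "h ` sphere 0 1 = C"
    and V: "compact V" "\<not> C \<subseteq> V"
    and \<epsilon>: "0 < \<epsilon>"
    and move: "\<And>t y. 0 < t \<Longrightarrow> t \<le> \<epsilon> \<Longrightarrow> y \<in> C \<Longrightarrow> f (t, y) \<noteq> y \<and> f (t, y) \<in> C \<union> V"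
    and J: "continuous_on ({0..1::real} \<times> C) J" "\<And>y. y \<in> C \<Longrightarrow> J (0, y) = f (\<epsilon>, y)"
      "\<And>y. y \<in> C \<Longrightarrow> J (1, y) \<in> C" "\<And>u y. u \<in> {0..1} \<Longrightarrow> y \<in> C \<Longrightarrow> J (u, y) \<noteq> y \<and> J (u, y) \<in> C \<union> V"
  shows "\<exists>x. \<forall>t. f (t, x) = x"
proof (rule ccontr)
  assume nofix: "\<nexists>x. \<forall>t. f (t, x) = x"
  have conth: "continuous_on (cball 0 1) h" and D_eq: "D = h ` cball 0 1"
    and contk: "continuous_on D k"
    using homeomorphism_cont1[OF hom] homeomorphism_image1[OF hom] homeomorphism_cont2[OF hom] by simp_all
  have U: "open (h ` ball 0 1)"
    using hom by (intro surface_invariance_of_domain assms continuous_on_subset[OF conth])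
      (auto intro: inj_on_inverseI[where g = k] simp: homeomorphism_apply1)
  have D: "compact D" using compact_continuous_image[OF conth] D_eq by simp
  have contS: "continuous_on (sphere 0 1) h" using continuous_on_subset[OF conth] by auto
  have compC: "compact C" unfolding C[symmetric] by (intro compact_continuous_image contS) auto
  have CD: "C \<subseteq> D" using C D_eq by auto
  have hS: "h z \<in> C" if "z \<in> sphere 0 1" for z using that C by blast
  have hD: "h z \<in> D" if "z \<in> cball 0 1" for z using that D_eq by blast
  have kh: "k (h z) = z" if "z \<in> cball 0 1" for z using that homeomorphism_apply1[OF hom] by blast
  obtain d where d: "d > 0" "\<And>e z. 0 < e \<Longrightarrow> e < d \<Longrightarrow> z \<in> cball 0 1 \<Longrightarrow> f (e, h z) \<noteq> h z"
    using flow_fixed_point_of_small_periods[OF f compact_cball conth] nofix by metis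
  have contf: "continuous_on S f" for S
    using f continuous_on_subset unfolding flow_def by blast
  define X where "X = (D \<union> V) \<union> f ` ({0..\<epsilon>} \<times> D)"
  have X: "compact X" "D \<union> V \<subseteq> X"
    unfolding X_def using D V(1) by (auto intro!: compact_Un compact_continuous_image contf compact_Times)
  obtain Z r where Z: "closed Z" "Z \<inter> (D \<union> V) = {}" and r: "continuous_on (X - Z) r"
    "\<And>z. z \<in> D \<Longrightarrow> r z = k z" "\<And>z. z \<in> X - Z \<Longrightarrow> z \<notin> D \<Longrightarrow> norm (r z) = 1"
    using disc_coordinate_extension[OF hom U V(1) _ X] V(2) C by metis
  \<comment> \<open>At time 0 the flow keeps \<open>D\<close> off \<open>Z\<close>, so by
    compactness it does so for all short times. This puts the images of all of \<open>D\<close>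
    inside the set on which \<open>r\<close> is continuous.\<close>
  have "open (f -` (- Z))"
    using Z(1) contf[of UNIV] by (auto simp: continuous_on_open_vimage)
  moreover have "{0} \<times> D \<subseteq> f -` (- Z)" using Z(2) f by auto
  ultimately obtain T0 where T0: "0 \<in> T0" "open T0" "T0 \<times> D \<subseteq> f -` (- Z)"
    using Elementary_Topology.tube_lemma[OF D] by metis
  then obtain e where e: "e > 0" "\<And>t. \<bar>t\<bar> < e \<Longrightarrow> t \<in> T0"
    unfolding open_dist dist_real_def by (metis diff_zero)
  \<comment> \<open>\<open>\<delta>\<close> is below \<open>d\<close> so that no point of
    \<open>D\<close> is fixed, below \<open>e\<close> so that the images avoid \<open>Z\<close>, and
    at most \<open>\<epsilon>\<close> so that \<open>move\<close> connects the two times on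
    \<open>C\<close>.\<close>
  define \<delta> where "\<delta> = min d (min e \<epsilon>) / 2"
  have \<delta>: "0 < \<delta>" "\<delta> < d" "\<delta> < e" "\<delta> \<le> \<epsilon>"
    using d(1) e(1) \<epsilon> by (auto simp: \<delta>_def min_def)
  have Z\<delta>: "f (\<delta>, y) \<notin> Z" if "y \<in> D" for y
    using T0(3) e(2)[of \<delta>] \<delta> that by auto
  define Y where "Y = (D \<union> V) \<union> (\<lambda>y. f (\<delta>, y)) ` D"
  have contf\<delta>: "continuous_on S (\<lambda>y. f (t, y))" for S t
    by (intro continuous_on_flow[OF f] continuous_intros)
  have Y: "compact Y" "D \<subseteq> Y" "Y \<subseteq> X - Z" "D \<union> V \<subseteq> Y"
    unfolding Y_def using D V(1) Z(2) Z\<delta> \<delta>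
    by (auto intro!: compact_Un compact_continuous_image contf\<delta> simp: X_def)
  \<comment> \<open>These sets hold the pairs of a point and its image met over the disc at time
    \<open>\<delta>\<close>, along \<open>C\<close> from \<open>\<delta>\<close> to
    \<open>\<epsilon>\<close>, and along \<open>C\<close> under \<open>J\<close>. A single
    \<open>W\<close> on their union makes the homotopies below fit together.\<close>
  define Q1 where "Q1 = (\<lambda>y. (y, f (\<delta>, y))) ` D"
  define Q2 where "Q2 = (\<lambda>(t, y). (y, f (t, y))) ` ({\<delta>..\<epsilon>} \<times> C)"
  define Q3 where "Q3 = (\<lambda>(u, y). (y, J (u, y))) ` ({0..1} \<times> C)"
  define Q where "Q = Q1 \<union> Q2 \<union> Q3"
  have "compact Q1" unfolding Q1_def
    using D contf\<delta> by (intro compact_continuous_image continuous_intros) auto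
  moreover have "compact Q2" unfolding Q2_def split_def
    using compC by (intro compact_continuous_image continuous_intros continuous_on_flow[OF f] compact_Times) auto
  moreover have "compact Q3" unfolding Q3_def split_def
    using compC J(1) by (intro compact_continuous_image continuous_intros compact_Times) auto
  ultimately have "compact Q" by (simp add: Q_def compact_Un)
  moreover have Q_cases: "y \<in> D \<and> z \<in> Y \<and> y \<noteq> z" if "(y, z) \<in> Q" for y z
    using that unfolding Q_def
  proof (elim UnE)
    assume "(y, z) \<in> Q1"
    then have yz: "y \<in> D" "z = f (\<delta>, y)" by (auto simp: Q1_def)
    then have "z \<noteq> y" using d(2)[OF \<delta>(1,2)] D_eq by auto
    with yz show ?thesis by (simp add: Y_def)
  next
    assume "(y, z) \<in> Q2"
    then obtain t where t: "t \<in> {\<delta>..\<epsilon>}" "y \<in> C" "z = f (t, y)" by (auto simp: Q2_def)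
    then have "z \<noteq> y \<and> z \<in> C \<union> V" using move[of t y] \<delta>(1) by simp
    then show ?thesis using t(2) CD Y(4) by blast
  next
    assume "(y, z) \<in> Q3"
    then obtain u where u: "u \<in> {0..1}" "y \<in> C" "z = J (u, y)" by (auto simp: Q3_def)
    then have "z \<noteq> y \<and> z \<in> C \<union> V" using J(4) by simp
    then show ?thesis using u(2) CD Y(4) by blast
  qed
  moreover have "Q \<subseteq> D \<times> Y" using Q_cases by auto
  ultimately obtain W :: "'a \<times> 'a \<Rightarrow> real ^ 2" where W: "continuous_on Q W" "\<And>p. p \<in> Q \<Longrightarrow> W p \<noteq> 0"
    "\<And>y z. (y, z) \<in> Q \<Longrightarrow> z \<in> D \<Longrightarrow> W (y, z) = k z - k y"
    using r(3) Y(3)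
    by (elim nonzero_difference_extension[OF hom U Y(1,2) continuous_on_subset[OF r(1) Y(3)] r(2), rotated 2]) auto
  let ?hom = "homotopic_with_canon (\<lambda>_. True) (sphere (0 :: real^2) 1) (- {0 :: real^2})"
  have q1: "(h z, f (\<delta>, h z)) \<in> Q" if "z \<in> cball 0 1" for z
    using hD[OF that] by (auto simp: Q_def Q1_def)
  have q2: "(h z, f (t, h z)) \<in> Q" if "z \<in> sphere 0 1" "t \<in> {\<delta>..\<epsilon>}" for z t
    using hS[OF that(1)] that(2) by (force simp: Q_def Q2_def)
  have q3: "(h z, J (u, h z)) \<in> Q" if "z \<in> sphere 0 1" "u \<in> {0..1}" for z u
    using hS[OF that(1)] that(2) by (force simp: Q_def Q3_def)
  have W_ne: "W p \<in> - {0}" if "p \<in> Q" for p using W(2)[OF that] by simp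
  \<comment> \<open>At time \<open>\<delta>\<close> the displacement is nonzero over the whole disc,
    so along the boundary it is null-homotopic.\<close>
  have "\<exists>c. ?hom (\<lambda>z. W (h z, f (\<delta>, h z))) (\<lambda>_. c)"
    unfolding nullhomotopic_from_sphere_extension
  proof (intro exI conjI ballI)
    show "continuous_on (cball 0 1) (\<lambda>z. W (h z, f (\<delta>, h z)))"
    proof (rule continuous_on_compose2[OF W(1)])
      show "(\<lambda>z. (h z, f (\<delta>, h z))) ` cball 0 1 \<subseteq> Q" by (rule image_subsetI) (rule q1)
    qed (intro continuous_on_Pair conth continuous_on_flow[OF f] continuous_on_const)
    show "(\<lambda>z. W (h z, f (\<delta>, h z))) ` cball 0 1 \<subseteq> - {0}"
      by (rule image_subsetI) (rule W_ne, rule q1)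
  qed simp
  then obtain c where 1: "?hom (\<lambda>z. W (h z, f (\<delta>, h z))) (\<lambda>_. c)" by blast
  have contS': "continuous_on ({0..1::real} \<times> sphere 0 1) (\<lambda>x. h (snd x))"
    by (rule continuous_on_compose2[OF contS]) (auto intro!: continuous_intros)
  have 2: "?hom (\<lambda>z. W (h z, f (\<delta>, h z))) (\<lambda>z. W (h z, f (\<epsilon>, h z)))"
  proof (rule homotopic_with_canonI)
    let ?t = "\<lambda>u. (1 - u) * \<delta> + u * \<epsilon>"
    have t: "?t u \<in> {\<delta>..\<epsilon>}" if "u \<in> {0..1}" for u
      using convex_bound_le[of \<delta> \<epsilon> \<epsilon> "1 - u" u] that \<delta> mult_left_mono[of \<delta> \<epsilon> u]
      by (auto simp: algebra_simps)
    show "continuous_on ({0..1} \<times> sphere 0 1) (\<lambda>x. W (h (snd x), f (?t (fst x), h (snd x))))"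
    proof (rule continuous_on_compose2[OF W(1)])
      show "(\<lambda>x. (h (snd x), f (?t (fst x), h (snd x)))) ` ({0..1} \<times> sphere 0 1) \<subseteq> Q"
        by (rule image_subsetI) (rule q2, use t in auto)
    qed (intro continuous_intros continuous_on_flow[OF f] contS')
    show "(\<lambda>x. W (h (snd x), f (?t (fst x), h (snd x)))) ` ({0..1} \<times> sphere 0 1) \<subseteq> - {0}"
      by (rule image_subsetI) (rule W_ne, rule q2, use t in auto)
  qed auto
  have 3: "?hom (\<lambda>z. W (h z, f (\<epsilon>, h z))) (\<lambda>z. W (h z, J (1, h z)))"
  proof (rule homotopic_with_canonI)
    show "continuous_on ({0..1} \<times> sphere 0 1) (\<lambda>x. W (h (snd x), J (fst x, h (snd x))))"
    proof (rule continuous_on_compose2[OF W(1)])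
      show "(\<lambda>x. (h (snd x), J (fst x, h (snd x)))) ` ({0..1} \<times> sphere 0 1) \<subseteq> Q"
        by (rule image_subsetI) (rule q3, auto)
      show "continuous_on ({0..1} \<times> sphere 0 1) (\<lambda>x. (h (snd x), J (fst x, h (snd x))))"
        by (intro continuous_intros contS' continuous_on_compose2[OF J(1), of _ "\<lambda>x. (fst x, h (snd x))"])
          (use hS in auto)
    qed
    show "(\<lambda>x. W (h (snd x), J (fst x, h (snd x)))) ` ({0..1} \<times> sphere 0 1) \<subseteq> - {0}"
      by (rule image_subsetI) (rule W_ne, rule q3, auto)
  qed (use J(2) hS in auto)
  have 4: "?hom (\<lambda>z. - z) (\<lambda>z. W (h z, J (1, h z)))"
  proof (rule homotopic_with_canonI)
    have contJ: "continuous_on ({0..1::real} \<times> sphere 0 1) (\<lambda>x. J (1, h (snd x)))"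
      by (rule continuous_on_compose2[OF J(1), of _ "\<lambda>x. (1, h (snd x))"])
        (use hS in \<open>auto intro!: continuous_on_Pair contS'\<close>)
    \<comment> \<open>Both vectors in the difference are unit before scaling, so a zero would force
      \<open>fst x = 1\<close>, and \<open>J (1, _)\<close> fixes no point.\<close>
    let ?H = "\<lambda>x. fst x *\<^sub>R k (J (1, h (snd x))) - snd x"
    show "continuous_on ({0..1::real} \<times> sphere 0 1) ?H"
      by (intro continuous_intros continuous_on_compose2[OF contk contJ]) (use J(3) CD hS in auto)
    have kJ: "norm (k (J (1, h z))) = 1" "k (J (1, h z)) \<noteq> z" if z: "z \<in> sphere 0 1" for z
    proof -
      obtain w where w: "w \<in> sphere 0 1" "J (1, h z) = h w" using J(3)[OF hS[OF z]] C by auto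
      then show "norm (k (J (1, h z))) = 1" using kh[of w] by simp
      have "w \<noteq> z" using w J(4)[OF _ hS[OF z], of 1] by auto
      then show "k (J (1, h z)) \<noteq> z" using w kh[of w] by simp
    qed
    have "u *\<^sub>R k (J (1, h z)) \<noteq> z" if "u \<in> {0..1}" "z \<in> sphere 0 1" for u z
    proof
      assume eq: "u *\<^sub>R k (J (1, h z)) = z"
      then have "\<bar>u\<bar> * norm (k (J (1, h z))) = norm z" by (metis norm_scaleR)
      then have "u = 1" using kJ(1)[OF that(2)] that by simp
      then show False using eq kJ(2)[OF that(2)] by simp
    qed
    then show "?H ` ({0..1} \<times> sphere 0 1) \<subseteq> - {0}" by auto
    show "?H (1, z) = W (h z, J (1, h z))" if "z \<in> sphere 0 1" for z
      using W(3)[OF q3[OF that, of 1]] J(3)[OF hS[OF that]] CD kh[of z] that by auto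
  qed auto
  show False
    by (rule minus_id_circle_essential, rule homotopic_with_trans[OF 4],
        rule homotopic_with_trans[OF homotopic_with_symD[OF 3]],
        rule homotopic_with_trans[OF homotopic_with_symD[OF 2] 1])
qed

section \<open>Simple loops, periodic orbits and close returns\<close>

lemma flow_eq_imp_period:
  assumes "flow f" "f (a, x) = f (b, x)"
  shows "f (b - a, x) = x"
  using flow_add[OF assms(1), of "-a" a x] flow_add[OF assms(1), of "-a" b x] assms by simp

text \<open>Loops are parametrised over \<open>{0..L}\<close> rather than the unit interval so that
  the parameter along an orbit is the flow time.\<close>

definition simple_loop_on :: "real \<Rightarrow> (real \<Rightarrow> 'a::topological_space) \<Rightarrow> bool" where
  "simple_loop_on L P \<longleftrightarrow> 0 < L \<and> continuous_on {0..L} P \<and> P L = P 0 \<and>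
     (\<forall>a b. 0 \<le> a \<and> a < b \<and> b \<le> L \<and> P a = P b \<longrightarrow> a = 0 \<and> b = L)"

lemma simple_loop_on_bounds_disc:
  fixes P :: "real \<Rightarrow> 'a::t2_space"
  assumes P: "simple_loop_on L P" and "Schoenflies TYPE('a)"
  obtains D h k where "homeomorphism (cball (0 :: real^2) 1) D h k" "h ` sphere 0 1 = P ` {0..L}"
proof -
  have L: "0 < L" using P by (simp add: simple_loop_on_def)
  define \<gamma> where "\<gamma> = P \<circ> (\<lambda>x. L * x)"
  have im: "(\<lambda>x. L * x) ` {0..1} = {0..L}"
    using L by simp
  have "path \<gamma>" unfolding path_def \<gamma>_def
    using P im by (intro continuous_on_compose continuous_intros) (simp add: simple_loop_on_def)
  moreover have "loop_free \<gamma>"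
  proof -
    have key: "x = 0 \<and> y = 1" if "0 \<le> x" "x < y" "y \<le> 1" "\<gamma> x = \<gamma> y" for x y
    proof -
      have "L * x = 0 \<and> L * y = L"
        using P that L unfolding simple_loop_on_def \<gamma>_def comp_def
        by (metis mult_left_le mult_nonneg_nonneg mult_strict_left_mono less_imp_le)
      then show ?thesis using L by simp
    qed
    show ?thesis unfolding loop_free_def
      by (metis key atLeastAtMost_iff linorder_neqE_linordered_idom)
  qed
  ultimately have "simple_path \<gamma>" by (simp add: simple_path_def)
  moreover have "pathfinish \<gamma> = pathstart \<gamma>"
    using P by (simp add: \<gamma>_def pathfinish_def pathstart_def simple_loop_on_def)
  ultimately have "path_image \<gamma> homeomorphic sphere (0 :: complex) 1"
    by (intro homeomorphic_simple_path_image_circle) auto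
  moreover have "sphere (0 :: complex) 1 homeomorphic sphere (0 :: real^2) 1"
    by (intro homeomorphic_spheres_gen) auto
  ultimately have "path_image \<gamma> homeomorphic sphere (0 :: real^2) 1"
    using homeomorphic_trans by blast
  then have "bounds_disc (path_image \<gamma>)"
    using assms(2) unfolding Schoenflies_def by blast
  moreover have "path_image \<gamma> = P ` {0..L}"
    unfolding path_image_def \<gamma>_def image_comp[symmetric] im ..
  ultimately show ?thesis using that unfolding bounds_disc_def by metis
qed

text \<open>\<open>P\<close> identifies only \<open>0\<close> with \<open>L\<close>, and
  \<open>j\<close> respects this, so \<open>j\<close> factors through the quotient map
  \<open>(u, s) \<mapsto> (u, P s)\<close>.\<close>

lemma simple_loop_on_homotopy_descends:
  fixes P :: "real \<Rightarrow> 'a::t2_space" and j :: "real \<times> real \<Rightarrow> 'b::topological_space"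
  assumes P: "simple_loop_on L P" and j: "continuous_on ({0..1} \<times> {0..L}) j"
    and ends: "\<And>u. u \<in> {0..1} \<Longrightarrow> j (u, 0) = j (u, L)"
  obtains J where "continuous_on ({0..1} \<times> P ` {0..L}) J"
    "\<And>u s. u \<in> {0..1} \<Longrightarrow> s \<in> {0..L} \<Longrightarrow> J (u, P s) = j (u, s)"
proof -
  define Q where "Q y = (SOME s. s \<in> {0..L} \<and> P s = y)" for y
  define J where "J = (\<lambda>(u, y). j (u, Q y))"
  have J: "J (u, P s) = j (u, s)" if "u \<in> {0..1}" "s \<in> {0..L}" for u s
  proof -
    have Q: "Q (P s) \<in> {0..L}" "P (Q (P s)) = P s"
      using someI[of "\<lambda>s'. s' \<in> {0..L} \<and> P s' = P s" s] that(2) unfolding Q_def by auto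
    then have "Q (P s) = s \<or> Q (P s) = 0 \<and> s = L \<or> Q (P s) = L \<and> s = 0"
      using P that(2) unfolding simple_loop_on_def
      by (metis atLeastAtMost_iff linorder_neqE_linordered_idom)
    then show ?thesis using ends[OF that(1)] by (auto simp: J_def)
  qed
  have "continuous_on ((\<lambda>x. (fst x, P (snd x))) ` ({0..1} \<times> {0..L})) J"
  proof (rule continuous_on_quotient_compact)
    have "continuous_on {0..L} P" using P by (simp add: simple_loop_on_def)
    then show "continuous_on ({0..1::real} \<times> {0..L}) (\<lambda>x. (fst x, P (snd x)))"
      by (intro continuous_on_Pair continuous_on_fst continuous_on_id
          continuous_on_compose2[of "{0..L}" P _ snd] continuous_on_snd) auto
    show "continuous_on ({0..1} \<times> {0..L}) (\<lambda>x. J (fst x, P (snd x)))"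
      by (rule continuous_on_eq[OF j]) (auto simp: J)
  qed (auto intro: compact_Times)
  moreover have "(\<lambda>x. (fst x, P (snd x))) ` ({0..1::real} \<times> {0..L}) = {0..1} \<times> P ` {0..L}"
    by force
  ultimately show ?thesis using that[of J] J by simp
qed

text \<open>Without a fixed point, \<open>x\<close> has a least positive period. The orbit is then a
  simple loop carried into itself by the flow, and the index criterion applies with empty
  \<open>V\<close> and a constant homotopy.\<close>

lemma flow_fixed_point_of_periodic_orbit:
  fixes f :: "real \<times> 'a::t2_space \<Rightarrow> 'a"
  assumes surf: "surface TYPE('a)" and sch: "Schoenflies TYPE('a)" and f: "flow f"
    and per: "T > 0" "f (T, x) = x"
  shows "\<exists>x. \<forall>t. f (t, x) = x"
proof (rule ccontr)
  assume nofix: "\<nexists>x. \<forall>t. f (t, x) = x"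
  have cont: "continuous_on S (\<lambda>s. f (s, y))" for S y
    by (intro continuous_on_flow[OF f] continuous_intros)
  obtain d where d: "d > 0" "\<And>e z. 0 < e \<Longrightarrow> e < d \<Longrightarrow> z \<in> {0} \<Longrightarrow> f (e, f (z, x)) \<noteq> f (z, x)"
    using flow_fixed_point_of_small_periods[OF f, where B = "{0::real}" and h = "\<lambda>s. f (s, x)", OF _ cont] nofix compact_sing by blast
  have d': "f (e, x) \<noteq> x" if "0 < e" "e < d" for e
    using d(2)[of e 0] that f by simp
  \<comment> \<open>Periods below \<open>d\<close> do not occur, so the positive periods up to
    \<open>T\<close> form a compact set and a least one exists.\<close>
  define K where "K = {t \<in> {d..T}. f (t, x) = x}"
  have "closed K" unfolding K_def by (intro continuous_closed_preimage_constant cont) auto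
  moreover have "bounded K" unfolding K_def by (rule bounded_subset[of "{d..T}"]) auto
  ultimately have "compact K" by (simp add: compact_eq_bounded_closed)
  moreover have "T \<in> K" using d'[of T] per by (force simp: K_def)
  ultimately obtain L where L: "L \<in> K" "\<And>t. t \<in> K \<Longrightarrow> L \<le> t"
    using compact_attains_inf by (metis empty_iff)
  have L0: "0 < L" "L \<le> T" "f (L, x) = x" using L(1) d(1) by (auto simp: K_def)
  have min: "f (t, x) \<noteq> x" if "0 < t" "t < L" for t
    using d'[of t] L(2)[of t] that L0 by (force simp: K_def)
  have loop: "simple_loop_on L (\<lambda>s. f (s, x))"
    unfolding simple_loop_on_def
  proof (intro conjI allI impI)
    fix a b assume ab: "0 \<le> a \<and> a < b \<and> b \<le> L \<and> f (a, x) = f (b, x)"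
    then have "f (b - a, x) = x" using flow_eq_imp_period[OF f] by blast
    then have "\<not> b - a < L" using min[of "b - a"] ab by auto
    then show "a = 0" "b = L" using ab by auto
  qed (use L0 f cont in auto)
  define C where "C = (\<lambda>s. f (s, x)) ` {0..L}"
  obtain D h k where D: "homeomorphism (cball (0 :: real^2) 1) D h k" "h ` sphere 0 1 = C"
    using simple_loop_on_bounds_disc[OF loop sch] unfolding C_def by metis
  have inv: "f (t, y) \<in> C" if "0 \<le> t" "t \<le> L" and y: "y \<in> C" for t y
  proof -
    obtain s where s: "s \<in> {0..L}" "y = f (s, x)" using y by (auto simp: C_def)
    have 1: "f (t, y) = f (t + s, x)" using s f by (simp add: flow_add)
    show ?thesis
    proof (cases "t + s \<le> L")
      case True
      then show ?thesis using 1 s that unfolding C_def by auto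
    next
      case False
      have "f (t + s, x) = f (t + s - L, f (L, x))" by (simp add: flow_add[OF f])
      then have "f (t, y) = f (t + s - L, x)" using 1 L0(3) by simp
      then show ?thesis using False s that unfolding C_def by auto
    qed
  qed
  have nonfix: "f (t, y) \<noteq> y" if "0 < t" "t \<le> L / 2" and y: "y \<in> C" for t y
  proof
    assume eq: "f (t, y) = y"
    obtain s where s: "y = f (s, x)" using y by (auto simp: C_def)
    have "f (s, x) = f (t + s, x)" using eq s flow_add[OF f, of t s x] by simp
    then have "f (t, x) = x" using flow_eq_imp_period[OF f] by fastforce
    then show False using min[of t] that L0 by simp
  qed
  have "\<exists>x. \<forall>t. f (t, x) = x"
  proof (rule flow_fixed_point_of_loop[OF surf f D, of "{}" "L/2" "\<lambda>(u, y). f (L/2, y)"])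
    show "continuous_on ({0..1} \<times> C) (\<lambda>(u, y). f (L/2, y))"
      unfolding split_def by (intro continuous_on_flow[OF f] continuous_intros)
    show "\<not> C \<subseteq> {}" using L0 by (auto simp: C_def)
  qed (use L0 inv nonfix in auto)
  then show False using nofix by blast
qed

text \<open>
  The circle \<open>C\<close> is the orbit segment from \<open>p\<close> to \<open>q = f (T, p)\<close> followed by the straight segment from
  \<open>q\<close> back to \<open>p\<close> in the chart, traversed in time \<open>\<tau>\<close>. On the part of \<open>C\<close> where \<open>f (\<epsilon>, _)\<close> leaves \<open>C\<close>,
  a straight-line homotopy in the chart joins it to the rotation of \<open>C\<close> by \<open>\<epsilon>\<close>.
\<close>

lemma flow_fixed_point_of_close_return:
  fixes f :: "real \<times> 'a::t2_space \<Rightarrow> 'a" and \<psi> :: "real^2 \<Rightarrow> 'a"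
  assumes surf: "surface TYPE('a)" and sch: "Schoenflies TYPE('a)" and f: "flow f"
    and noper: "\<And>t x. t \<noteq> 0 \<Longrightarrow> f (t, x) \<noteq> x"
    and hom: "homeomorphism (cball c R) V \<psi> \<phi>"
    and W: "W = \<psi> ` ball c \<rho>" "0 < \<rho>" "\<rho> \<le> R"
    and par: "0 < \<tau>" "\<tau> < \<epsilon>" "\<epsilon> < 1" "1 \<le> T"
    and pq: "p \<in> W" "f (T, p) \<in> W" "f (1, p) \<notin> V"
    and gap: "\<And>s. s \<in> {0..T} \<Longrightarrow> f (s, p) \<notin> \<psi> ` open_segment (\<phi> (f (T, p))) (\<phi> p)"
    and close: "\<And>w t. w \<in> W \<Longrightarrow> t \<in> {-\<epsilon>..\<epsilon>} \<Longrightarrow>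
                  f (t, w) \<in> V \<and> dist (\<phi> (f (t, w))) (\<phi> (f (t, \<psi> c))) < \<eta>"
    and unif: "\<And>s t. s \<in> {0..\<epsilon>} \<Longrightarrow> t \<in> {0..\<epsilon>} \<Longrightarrow> \<bar>s - t\<bar> \<le> \<tau> \<Longrightarrow>
                  dist (\<phi> (f (s, \<psi> c))) (\<phi> (f (t, \<psi> c))) < \<eta>"
    and sep: "\<And>t. t \<in> {-\<epsilon>..0} \<Longrightarrow> 4 * \<eta> \<le> dist (\<phi> (f (t, \<psi> c))) (\<phi> (f (t + \<epsilon>, \<psi> c)))"
  shows "\<exists>x. \<forall>t. f (t, x) = x"
proof -
  define q where "q = f (T, p)"
  define L where "L = T + \<tau>"
  have V_eq: "V = \<psi> ` cball c R" and cont\<psi>: "continuous_on (cball c R) \<psi>" and cont\<phi>: "continuous_on V \<phi>"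
    using homeomorphism_image1[OF hom] homeomorphism_cont1[OF hom] homeomorphism_cont2[OF hom] by simp_all
  have compV: "compact V" using compact_continuous_image[OF cont\<psi>] V_eq by simp
  have \<phi>\<psi>: "\<phi> (\<psi> z) = z" if "z \<in> cball c R" for z using homeomorphism_apply1[OF hom that] .
  have \<psi>\<phi>: "\<psi> (\<phi> y) = y" "\<phi> y \<in> cball c R" if "y \<in> V" for y
    using homeomorphism_apply2[OF hom that] homeomorphism_image2[OF hom] that by auto
  have \<psi>V: "\<psi> z \<in> V" if "z \<in> cball c R" for z using that V_eq by blast
  have ballR: "ball c \<rho> \<subseteq> cball c R" using W(3) by auto
  have WV: "W \<subseteq> V" using W(1) V_eq ballR by auto
  have \<phi>W: "\<phi> y \<in> ball c \<rho>" if "y \<in> W" for y using that W(1) \<phi>\<psi> ballR by auto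
  have cont: "continuous_on S (\<lambda>s. f (s, y))" for S y
    by (intro continuous_on_flow[OF f] continuous_intros)
  have inj: "a = b" if "f (a, y) = f (b, y)" for a b y
    using flow_eq_imp_period[OF f that] noper[of "b - a"] by auto
  have qW: "q \<in> W" and q: "q = f (T, p)" using pq by (simp_all add: q_def)
  have qp: "q \<noteq> p" using noper[of T p] par by (simp add: q_def)
  have \<phi>qp: "\<phi> q \<noteq> \<phi> p" using \<psi>\<phi>(1) qp qW pq(1) WV by (metis subsetD)
  \<comment> \<open>Clamping the parameter makes \<open>l\<close> continuous on the whole line, with
    all values on the segment from \<open>\<phi> q\<close> to \<open>\<phi> p\<close>.\<close>
  define l where "l s = linepath (\<phi> q) (\<phi> p) (max 0 (min 1 ((s - T) / \<tau>)))" for s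
  have l_ball: "l s \<in> ball c \<rho>" for s
  proof -
    have "l s \<in> closed_segment (\<phi> q) (\<phi> p)"
      unfolding l_def using par by (intro linepath_in_path) auto
    then show ?thesis
      using closed_segment_subset[of "\<phi> q" "ball c \<rho>" "\<phi> p"] \<phi>W qW pq(1) by auto
  qed
  have contl: "continuous_on S l" for S
    unfolding l_def by (intro continuous_on_compose2[OF continuous_on_linepath[of UNIV]] continuous_intros) (use par in auto)
  have l_lin: "l s = linepath (\<phi> q) (\<phi> p) ((s - T) / \<tau>)" if "s \<in> {T..L}" for s
    using that par by (auto simp: l_def L_def field_simps max_def min_def)
  have lT: "l T = \<phi> q" and lL: "l L = \<phi> p"
    using par l_lin[of T] l_lin[of L] by (auto simp: linepath_def L_def)
  \<comment> \<open>Beyond \<open>L\<close> the loop starts its next turn, so rotation by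
    \<open>\<epsilon>\<close> is \<open>P (s + \<epsilon>)\<close> with no reduction modulo
    \<open>L\<close>.\<close>
  define P where "P s = (if s \<le> T then f (s, p) else if s \<le> L then \<psi> (l s) else f (s - L, p))" for s
  have TL: "0 < T" "T < L" using par by (simp_all add: L_def)
  have cont\<psi>l: "continuous_on S (\<lambda>s. \<psi> (l s))" for S
    by (rule continuous_on_compose2[OF cont\<psi> contl]) (use l_ball ballR in auto)
  have contP: "continuous_on S P" for S
    unfolding P_def
  proof (intro continuous_on_cases_le cont cont\<psi>l continuous_on_id continuous_on_flow[OF f] continuous_intros)
    show "\<psi> (l s) = f (s - L, p)" if "s = L" for s
      using that lL \<psi>\<phi> pq WV f by auto
    show "f (s, p) = (if s \<le> L then \<psi> (l s) else f (s - L, p))" if "s = T" for s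
      using that TL lT \<psi>\<phi> qW WV q by auto
  qed
  have PT: "P s = f (s, p)" if "s \<le> T" for s using that by (simp add: P_def)
  have Pl: "P s = \<psi> (l s)" if "s \<in> {T..L}" for s
    using that lT \<psi>\<phi> qW WV q by (cases "s = T") (auto simp: P_def)
  have PL: "P s = f (s - L, p)" if "L \<le> s" for s
    using that TL Pl[of L] lL \<psi>\<phi> pq WV f by (cases "s = L") (auto simp: P_def)
  have loop: "simple_loop_on L P"
    unfolding simple_loop_on_def
  proof (intro conjI allI impI)
    show "0 < L" using TL by simp
    show "continuous_on {0..L} P" by (rule contP)
    show "P L = P 0" using PL[of L] PT[of 0] TL by simp
    have "a = 0 \<and> b = L" if ab: "0 \<le> a" "a < b" "b \<le> L" and eq: "P a = P b" for a b
    proof -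
      consider "b \<le> T" | "a \<le> T" "T < b" "b < L" | "a \<le> T" "b = L" | "T < a" using ab by linarith
      then show ?thesis
      proof cases
        case 1
        then show ?thesis using eq ab inj[of a p b] PT by simp
      next
        case 2
        have "(b - T) / \<tau> \<in> {0<..<1}" using 2 par by (auto simp: L_def)
        then have "l b \<in> open_segment (\<phi> q) (\<phi> p)"
          using l_lin[of b] 2 \<phi>qp by (auto simp: in_segment linepath_def)
        then have "P b \<in> \<psi> ` open_segment (\<phi> q) (\<phi> p)" using Pl[of b] 2 by auto
        then show ?thesis using gap[of a] 2 ab eq PT[of a] by (simp add: q_def)
      next
        case 3
        then show ?thesis using eq inj[of a p 0] PL[of L] PT[of a] by simp
      next
        case 4
        then have "\<psi> (l a) = \<psi> (l b)" using eq Pl[of a] Pl[of b] ab by simp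
        then have "l a = l b" using l_ball ballR \<phi>\<psi> by (metis subsetD)
        then have "(a - T) / \<tau> = (b - T) / \<tau>"
          using l_lin[of a] l_lin[of b] 4 ab par
          by (intro inj_onD[OF inj_on_linepath[OF \<phi>qp]]) (auto simp: L_def)
        then show ?thesis using ab par by simp
      qed
    qed
    then show "a = 0" "b = L" if "0 \<le> a \<and> a < b \<and> b \<le> L \<and> P a = P b" for a b
      using that by blast+
  qed
  define C where "C = P ` {0..L}"
  obtain D h k where D: "homeomorphism (cball (0 :: real^2) 1) D h k" "h ` sphere 0 1 = C"
    using simple_loop_on_bounds_disc[OF loop sch] unfolding C_def by metis
  have P_plus_C: "P (s + \<epsilon>) \<in> C" if "s \<in> {0..L}" for s
  proof (cases "s + \<epsilon> \<le> L")
    case True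
    then show ?thesis using that par by (auto simp: C_def)
  next
    case False
    then have "P (s + \<epsilon>) = P (s + \<epsilon> - L)" using PL[of "s + \<epsilon>"] PT[of "s + \<epsilon> - L"] that par by simp
    then show ?thesis using False that par TL by (auto simp: C_def)
  qed
  \<comment> \<open>\<open>a s\<close> is the time for which \<open>P s\<close> is close to \<open>f (a s, \<psi> c)\<close>.\<close>
  define a where "a s = min (s - T) 0" for s
  have W_pt: "P s \<in> W" if "s \<in> {T..L}" for s
    using that Pl l_ball W(1) by auto
  have late: "P s = f (a s, if s \<le> T then q else P s)" for s
    using flow_add[OF f, of "s - T" T p] PT[of s] f by (simp add: a_def q_def)
  have near: "f (t, P s) \<in> V \<and> dist (\<phi> (f (t, P s))) (\<phi> (f (a s + t, \<psi> c))) < \<eta>"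
    if "s \<in> {T - \<epsilon>..L}" "t \<in> {0..\<epsilon>}" for s t
  proof -
    have "f (t, P s) = f (a s + t, if s \<le> T then q else P s)"
      by (subst late) (simp add: flow_add[OF f] add.commute)
    moreover have "(if s \<le> T then q else P s) \<in> W" using W_pt that qW by auto
    moreover have "a s + t \<in> {-\<epsilon>..\<epsilon>}" using that by (auto simp: a_def)
    ultimately show ?thesis using close by metis
  qed
  \<comment> \<open>The segment is traversed in time \<open>\<tau>\<close>, so rotation and flow
    differ in timing by at most \<open>\<tau>\<close>. By \<open>unif\<close> this costs one further
    \<open>\<eta>\<close> on top of \<open>close\<close>.\<close>
  have next_near: "P (s + \<epsilon>) \<in> V \<and> dist (\<phi> (P (s + \<epsilon>))) (\<phi> (f (a s + \<epsilon>, \<psi> c))) < 2 * \<eta>"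
    if s: "s \<in> {T - \<epsilon>..L}" for s
  proof (cases "s + \<epsilon> \<le> L")
    case True
    have "P (s + \<epsilon>) \<in> W" using W_pt[of "s + \<epsilon>"] True s by simp
    then have 1: "P (s + \<epsilon>) \<in> V \<and> dist (\<phi> (P (s + \<epsilon>))) (\<phi> (f (0, \<psi> c))) < \<eta>"
      using close[of "P (s + \<epsilon>)" 0] par f by simp
    have "dist (\<phi> (f (0, \<psi> c))) (\<phi> (f (a s + \<epsilon>, \<psi> c))) < \<eta>"
      using True s par by (intro unif) (auto simp: a_def L_def)
    then show ?thesis using 1 dist_triangle[of "\<phi> (P (s + \<epsilon>))" "\<phi> (f (a s + \<epsilon>, \<psi> c))" "\<phi> (f (0, \<psi> c))"]
      by simp
  next
    case False
    have 1: "P (s + \<epsilon>) \<in> V \<and> dist (\<phi> (P (s + \<epsilon>))) (\<phi> (f (s + \<epsilon> - L, \<psi> c))) < \<eta>"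
      using close[OF pq(1), of "s + \<epsilon> - L"] False s par PL[of "s + \<epsilon>"] by simp
    have "dist (\<phi> (f (s + \<epsilon> - L, \<psi> c))) (\<phi> (f (a s + \<epsilon>, \<psi> c))) < \<eta>"
      using False s par by (intro unif) (auto simp: a_def L_def min_def)
    then show ?thesis
      using 1 dist_triangle[of "\<phi> (P (s + \<epsilon>))" "\<phi> (f (a s + \<epsilon>, \<psi> c))" "\<phi> (f (s + \<epsilon> - L, \<psi> c))"]
      by simp
  qed
  define m where "m x = (1 - fst x) *\<^sub>R \<phi> (f (\<epsilon>, P (snd x))) + fst x *\<^sub>R \<phi> (P (snd x + \<epsilon>))" for x
  have m_cball: "m (u, s) \<in> cball c R"
    and m_far: "\<psi> (m (u, s)) \<noteq> P s" if us: "u \<in> {0..1}" "s \<in> {T - \<epsilon>..L}" for u s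
  proof -
    have n: "f (\<epsilon>, P s) \<in> V" "dist (\<phi> (f (\<epsilon>, P s))) (\<phi> (f (a s + \<epsilon>, \<psi> c))) < \<eta>"
      using near[OF us(2), of \<epsilon>] par by auto
    have n': "P (s + \<epsilon>) \<in> V" "dist (\<phi> (P (s + \<epsilon>))) (\<phi> (f (a s + \<epsilon>, \<psi> c))) < 2 * \<eta>"
      using next_near[OF us(2)] by auto
    have n0: "P s \<in> V" "dist (\<phi> (P s)) (\<phi> (f (a s, \<psi> c))) < \<eta>"
      using near[OF us(2), of 0] par f by auto
    show mem: "m (u, s) \<in> cball c R"
      unfolding m_def fst_conv snd_conv
      using us(1) by (intro convexD_alt[OF convex_cball] \<psi>\<phi>(2) n(1) n'(1)) auto
    have \<eta>: "\<eta> > 0" using n(2) zero_le_dist le_less_trans by blast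
    have "m (u, s) \<in> ball (\<phi> (f (a s + \<epsilon>, \<psi> c))) (2 * \<eta>)"
      unfolding m_def fst_conv snd_conv
      using us(1) n(2) n'(2) \<eta> by (intro convexD_alt[OF convex_ball]) (auto simp: dist_commute)
    then have d: "dist (\<phi> (f (a s + \<epsilon>, \<psi> c))) (m (u, s)) < 2 * \<eta>" by simp
    \<comment> \<open>The deformed image is within \<open>2 * \<eta>\<close> of the model point at
      time \<open>a s + \<epsilon>\<close>, and \<open>P s\<close> within \<open>\<eta>\<close> of
      the one at time \<open>a s\<close>; a separation of \<open>4 * \<eta>\<close> keeps them
      apart.\<close>
    have "4 * \<eta> \<le> dist (\<phi> (f (a s, \<psi> c))) (\<phi> (f (a s + \<epsilon>, \<psi> c)))"
      using us(2) par by (intro sep) (auto simp: a_def)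
    show "\<psi> (m (u, s)) \<noteq> P s"
    proof
      assume "\<psi> (m (u, s)) = P s"
      then have "m (u, s) = \<phi> (P s)" using \<phi>\<psi>[OF mem] by simp
      then show False
        using d n0(2) \<eta> \<open>4 * \<eta> \<le> _\<close>
          dist_triangle[of "\<phi> (f (a s, \<psi> c))" "\<phi> (f (a s + \<epsilon>, \<psi> c))" "\<phi> (P s)"]
        by (simp add: dist_commute)
    qed
  qed
  \<comment> \<open>Up to \<open>T - \<epsilon>\<close> flow and rotation agree exactly, so nothing
    is deformed there; at \<open>T - \<epsilon>\<close> both ends of the line homotopy are
    \<open>\<phi> q\<close>, so the two pieces match.\<close>
  define j where "j x = (if snd x \<le> T - \<epsilon> then f (snd x + \<epsilon>, p) else \<psi> (m x))" for x
  have j_early: "j (u, s) = P (s + \<epsilon>)" "f (\<epsilon>, P s) = P (s + \<epsilon>)" if "s \<le> T - \<epsilon>" for u s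
    using that par PT flow_add[OF f] by (simp_all add: j_def add.commute)
  have j_late: "j (u, s) = \<psi> (m (u, s))" if "s > T - \<epsilon>" for u s
    using that by (simp add: j_def)
  have contj: "continuous_on ({0..1} \<times> {0..L}) j"
    unfolding j_def
  proof (rule continuous_on_cases_le)
    let ?S = "{x \<in> {0..1} \<times> {0..L}. T - \<epsilon> \<le> snd x}"
    have S: "snd x \<in> {T - \<epsilon>..L}" "fst x \<in> {0..1}" if "x \<in> ?S" for x using that by auto
    have contPs: "continuous_on ?S (\<lambda>x. P (snd x))" "continuous_on ?S (\<lambda>x. P (snd x + \<epsilon>))"
      by (intro continuous_on_compose2[OF contP[of UNIV]] continuous_intros subset_UNIV)+
    show "continuous_on ?S (\<lambda>x. \<psi> (m x))"
    proof (rule continuous_on_compose2[OF cont\<psi>])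
      show "m ` ?S \<subseteq> cball c R" using m_cball S by force
      show "continuous_on ?S m" unfolding m_def
      proof (intro continuous_on_add continuous_on_scaleR continuous_on_diff continuous_on_const
          continuous_on_fst continuous_on_id continuous_on_compose2[OF cont\<phi>] continuous_on_flow[OF f] contPs)
        show "(\<lambda>x. f (\<epsilon>, P (snd x))) ` ?S \<subseteq> V"
          using near[of _ \<epsilon>] S par by (intro image_subsetI) auto
        show "(\<lambda>x. P (snd x + \<epsilon>)) ` ?S \<subseteq> V"
          using next_near S by (intro image_subsetI) auto
      qed
    qed
    show "f (snd x + \<epsilon>, p) = \<psi> (m x)" if "x \<in> {0..1} \<times> {0..L}" "snd x = T - \<epsilon>" for x
    proof -
      have "m x = \<phi> q"
        using j_early(2)[of "T - \<epsilon>"] PT[of T] that(2)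
        by (simp add: m_def q_def scaleR_left_distrib[symmetric])
      then show ?thesis using that(2) \<psi>\<phi>(1) qW WV q by auto
    qed
  qed (intro continuous_on_flow[OF f] continuous_intros)+
  \<comment> \<open>At \<open>s = L\<close> the line homotopy is again constant, because the next
    turn follows the orbit of \<open>P L = p\<close>.\<close>
  have j_ends: "j (u, 0) = j (u, L)" if "u \<in> {0..1}" for u
  proof -
    have "P (L + \<epsilon>) = f (\<epsilon>, p)" "P L = p" using PL[of "L + \<epsilon>"] PL[of L] par f by simp_all
    then have "m (u, L) = \<phi> (f (\<epsilon>, p))"
      by (simp add: m_def scaleR_left_distrib[symmetric])
    moreover have "f (\<epsilon>, p) \<in> V" using close[OF pq(1), of \<epsilon>] par by simp
    ultimately have "j (u, L) = f (\<epsilon>, p)" using j_late[of L] TL par \<psi>\<phi>(1) by simp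
    then show ?thesis using par by (simp add: j_def)
  qed
  obtain J where J: "continuous_on ({0..1} \<times> C) J"
    "\<And>u s. u \<in> {0..1} \<Longrightarrow> s \<in> {0..L} \<Longrightarrow> J (u, P s) = j (u, s)"
    using simple_loop_on_homotopy_descends[OF loop contj j_ends] unfolding C_def by metis
  show ?thesis
  proof (rule flow_fixed_point_of_loop[OF surf f D compV])
    have "f (1, p) \<in> C" using PT[of 1] par TL unfolding C_def by (intro image_eqI[of _ _ 1]) auto
    then show "\<not> C \<subseteq> V" using pq(3) by blast
    show "0 < \<epsilon>" using par by simp
    show "continuous_on ({0..1} \<times> C) J" by (rule J)
  next
    fix t y assume t: "0 < t" "t \<le> \<epsilon>" and y: "y \<in> C"
    obtain s where s: "s \<in> {0..L}" "y = P s" using y by (auto simp: C_def)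
    have "f (t, P s) \<in> C \<union> V"
    proof (cases "s + t \<le> T")
      case True
      then have "f (t, P s) = P (s + t)" using PT s t flow_add[OF f] by (simp add: add.commute)
      then show ?thesis using True s t TL by (auto simp: C_def)
    next
      case False
      then show ?thesis using near[of s t] s t by simp
    qed
    then show "f (t, y) \<noteq> y \<and> f (t, y) \<in> C \<union> V" using noper[of t y] t s by simp
  next
    fix y assume y: "y \<in> C"
    obtain s where s: "s \<in> {0..L}" "y = P s" using y by (auto simp: C_def)
    show "J (0, y) = f (\<epsilon>, y)"
    proof (cases "s \<le> T - \<epsilon>")
      case True
      then show ?thesis using J(2)[of 0 s] s j_early by simp
    next
      case False
      then have "f (\<epsilon>, P s) \<in> V" using near[of s \<epsilon>] s par by simp
      then show ?thesis using False J(2)[of 0 s] s j_late[of s 0] \<psi>\<phi>(1) by (simp add: m_def)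
    qed
    show "J (1, y) \<in> C"
    proof (cases "s \<le> T - \<epsilon>")
      case True
      then show ?thesis using J(2)[of 1 s] s j_early P_plus_C by simp
    next
      case False
      then have "P (s + \<epsilon>) \<in> V" using next_near[of s] s by simp
      then show ?thesis using False J(2)[of 1 s] s j_late[of s 1] \<psi>\<phi>(1) P_plus_C by (simp add: m_def)
    qed
  next
    fix u :: real and y assume u: "u \<in> {0..1}" and y: "y \<in> C"
    obtain s where s: "s \<in> {0..L}" "y = P s" using y by (auto simp: C_def)
    show "J (u, y) \<noteq> y \<and> J (u, y) \<in> C \<union> V"
    proof (cases "s \<le> T - \<epsilon>")
      case True
      have "f (\<epsilon>, P s) \<noteq> P s" using noper par by simp
      then show ?thesis using True J(2)[OF u s(1)] s j_early P_plus_C by simp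
    next
      case False
      then have "s \<in> {T - \<epsilon>..L}" using s by simp
      then show ?thesis using False J(2)[OF u s(1)] s j_late[of s u] m_far[OF u] \<psi>V[OF m_cball[OF u]] by simp
    qed
  qed
qed

text \<open>
  Among all pairs of times at distance at least 1 at which the orbit meets a fixed straight segment
  in \<open>W\<close>, take one whose points are closest: \<open>excl\<close> makes the time gap exceed 2, so a further visit
  between the two points would be at time distance at least 1 from one of them.
\<close>

lemma flow_closest_return:
  fixes f :: "real \<times> 'a::t2_space \<Rightarrow> 'a" and \<psi> :: "real^2 \<Rightarrow> 'a"
  assumes f: "flow f"
    and hom: "homeomorphism (cball c R) V \<psi> \<phi>"
    and W: "W = \<psi> ` ball c \<rho>" "\<rho> \<le> R"
    and excl: "\<And>t w. t \<in> {1..2} \<Longrightarrow> w \<in> W \<Longrightarrow> f (t, w) \<notin> W"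
    and ret: "a \<in> W" "1 \<le> T0" "f (T0, a) \<in> W"
  obtains p T where "p \<in> W" "f (T, p) \<in> W" "1 \<le> T"
    "\<And>s. s \<in> {0..T} \<Longrightarrow> f (s, p) \<notin> \<psi> ` open_segment (\<phi> (f (T, p))) (\<phi> p)"
proof -
  have ballR: "ball c \<rho> \<subseteq> cball c R" using W(2) by auto
  have \<phi>\<psi>: "\<phi> (\<psi> z) = z" if "z \<in> cball c R" for z using homeomorphism_apply1[OF hom that] .
  have WV: "W \<subseteq> V" using W(1) homeomorphism_image1[OF hom] ballR by auto
  have \<phi>W: "\<phi> y \<in> ball c \<rho>" if "y \<in> W" for y using that W(1) \<phi>\<psi> ballR by auto
  define \<gamma> where "\<gamma> s = f (s, a)" for s
  have \<gamma>_add: "f (t, \<gamma> s) = \<gamma> (s + t)" for s t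
    unfolding \<gamma>_def by (simp add: flow_add[OF f] add.commute)
  have cont: "continuous_on S (\<lambda>z. \<gamma> (g z))" if "continuous_on S g" for S g
    unfolding \<gamma>_def by (intro continuous_on_flow[OF f] that continuous_intros)
  \<comment> \<open>Recording visits to the image of a closed segment instead of \<open>W\<close>
    makes \<open>E\<close> compact; convexity of \<open>K\<close> keeps the segment between two
    recorded points inside it.\<close>
  define K where "K = closed_segment (\<phi> a) (\<phi> (f (T0, a)))"
  have K: "K \<subseteq> ball c \<rho>"
    unfolding K_def using ret \<phi>W by (intro closed_segment_subset) auto
  have KW: "\<psi> ` K \<subseteq> W" using K W(1) by auto
  have "compact (\<psi> ` K)"
    using K ballR unfolding K_def
    by (intro compact_continuous_image continuous_on_subset[OF homeomorphism_cont1[OF hom]]) auto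
  then have clK: "closed (\<psi> ` K)" by (rule compact_imp_closed)
  define E where "E = ({0..T0} \<times> {0..T0}) \<inter> {z. 1 \<le> snd z - fst z}
    \<inter> (\<lambda>z. \<gamma> (fst z)) -` (\<psi> ` K) \<inter> (\<lambda>z. \<gamma> (snd z)) -` (\<psi> ` K)"
  have "closed {z :: real \<times> real. 1 \<le> snd z - fst z}"
    by (intro closed_Collect_le continuous_intros)
  then have "compact E" unfolding E_def
    by (intro compact_Int_closed compact_Times closed_vimage clK cont continuous_intros) auto
  moreover have ends: "\<gamma> T0 \<in> \<psi> ` K" "\<gamma> 0 \<in> \<psi> ` K"
  proof -
    have "\<gamma> T0 = \<psi> (\<phi> (f (T0, a)))" "\<gamma> 0 = \<psi> (\<phi> a)"
      using ret WV homeomorphism_apply2[OF hom] f by (auto simp: \<gamma>_def)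
    then show "\<gamma> T0 \<in> \<psi> ` K" "\<gamma> 0 \<in> \<psi> ` K" by (auto simp: K_def)
  qed
  moreover have "(0, T0) \<in> E" using ends ret(2) by (auto simp: E_def)
  moreover have "continuous_on E (\<lambda>z. dist (\<phi> (\<gamma> (fst z))) (\<phi> (\<gamma> (snd z))))"
    by (intro continuous_on_dist continuous_on_compose2[OF homeomorphism_cont2[OF hom] cont] continuous_intros)
      (use KW WV in \<open>auto simp: E_def\<close>)
  ultimately obtain z where z: "z \<in> E"
    "\<And>z'. z' \<in> E \<Longrightarrow> dist (\<phi> (\<gamma> (fst z))) (\<phi> (\<gamma> (snd z))) \<le> dist (\<phi> (\<gamma> (fst z'))) (\<phi> (\<gamma> (snd z')))"
    using continuous_attains_inf[of E "\<lambda>z. dist (\<phi> (\<gamma> (fst z))) (\<phi> (\<gamma> (snd z)))"] by blast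
  obtain s1 s2 where s: "z = (s1, s2)" by fastforce
  have s12: "0 \<le> s1" "s2 \<le> T0" "1 \<le> s2 - s1" "\<gamma> s1 \<in> \<psi> ` K" "\<gamma> s2 \<in> \<psi> ` K"
    using z(1) s by (auto simp: E_def)
  show ?thesis
  proof (rule that)
    show 1: "\<gamma> s1 \<in> W" "f (s2 - s1, \<gamma> s1) \<in> W" "1 \<le> s2 - s1"
      using s12 KW by (auto simp: \<gamma>_add)
    show "f (s, \<gamma> s1) \<notin> \<psi> ` open_segment (\<phi> (f (s2 - s1, \<gamma> s1))) (\<phi> (\<gamma> s1))" if s': "s \<in> {0..s2 - s1}" for s
    proof
      define r where "r = s1 + s"
      assume "f (s, \<gamma> s1) \<in> \<psi> ` open_segment (\<phi> (f (s2 - s1, \<gamma> s1))) (\<phi> (\<gamma> s1))"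
      then obtain y where y: "y \<in> open_segment (\<phi> (\<gamma> s2)) (\<phi> (\<gamma> s1))" "\<gamma> r = \<psi> y"
        by (auto simp: \<gamma>_add r_def)
      have "\<phi> (\<gamma> s1) \<in> K" "\<phi> (\<gamma> s2) \<in> K" using s12 \<phi>\<psi> K ballR by auto
      then have "y \<in> K"
        using y(1) closed_segment_subset[of "\<phi> (\<gamma> s2)" K "\<phi> (\<gamma> s1)"] segment_open_subset_closed
        unfolding K_def by blast
      then have r: "\<gamma> r \<in> \<psi> ` K" "\<phi> (\<gamma> r) = y" using y(2) \<phi>\<psi> K ballR by auto
      have d: "dist (\<phi> (\<gamma> r)) (\<phi> (\<gamma> s2)) < dist (\<phi> (\<gamma> s1)) (\<phi> (\<gamma> s2))"
        "dist (\<phi> (\<gamma> s1)) (\<phi> (\<gamma> r)) < dist (\<phi> (\<gamma> s1)) (\<phi> (\<gamma> s2))"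
        using dist_in_open_segment[OF y(1)] r(2) by (simp_all add: dist_commute)
      have "(s1, r) \<notin> E" "(r, s2) \<notin> E" using z(2)[of "(s1, r)"] z(2)[of "(r, s2)"] d s by auto
      then have "s < 1" "s2 - r < 1" using s12 r(1) s' by (auto simp: E_def r_def)
      then have "s2 - s1 \<in> {1..2}" using s12 by (auto simp: r_def)
      then show False using excl 1 by blast
    qed
  qed
qed

section \<open>Charts and the final choice of constants\<close>

text \<open>Shrinking a chart to a closed round ball keeps straight segments inside it and makes its
  image \<open>V\<close> compact.\<close>

lemma surface_chart:
  fixes x0 :: "'a::t2_space"
  assumes "surface TYPE('a)" "open G" "x0 \<in> G"
  obtains c :: "real^2" and R V \<psi> \<phi> where "0 < R" "homeomorphism (cball c R) V \<psi> \<phi>" "\<psi> c = x0" "V \<subseteq> G"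
proof -
  obtain U O' where U: "open U" "x0 \<in> U" "open (O' :: (real^2) set)" "U homeomorphic O'"
    using assms(1) unfolding surface_def by meson
  then obtain \<phi> \<psi> where hom: "homeomorphism U O' \<phi> \<psi>"
    unfolding homeomorphic_def by auto
  have "open (O' \<inter> \<psi> -` G)"
    using continuous_open_preimage[OF homeomorphism_cont2[OF hom] U(3) assms(2)] .
  moreover have "\<phi> x0 \<in> O' \<inter> \<psi> -` G"
    using U(2) assms(3) homeomorphism_apply1[OF hom] homeomorphism_image1[OF hom] by auto
  ultimately obtain R where R: "R > 0" "cball (\<phi> x0) R \<subseteq> O' \<inter> \<psi> -` G"
    using open_contains_cball by meson
  show ?thesis
  proof
    show "homeomorphism (cball (\<phi> x0) R) (\<psi> ` cball (\<phi> x0) R) \<psi> \<phi>"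
      using homeomorphism_of_subsets[OF homeomorphism_symD[OF hom], of "cball (\<phi> x0) R"] R(2)
        homeomorphism_image2[OF hom] by blast
  qed (use R U(2) homeomorphism_apply1[OF hom] in auto)
qed

theorem theorem4p5:
  fixes f :: "real \<times> 'a::t2_space \<Rightarrow> 'a"
  assumes "surface TYPE('a)"
    and "omega_bounded TYPE('a)"
    and "Schoenflies TYPE('a)"
    and "flow f"
  shows "\<exists>x. \<forall>t. f (t, x) = x"
proof (rule ccontr)
  assume nofix: "\<nexists>x. \<forall>t. f (t, x) = x"
  note surf = assms(1) and f = assms(4)
  have cont: "continuous_on S (\<lambda>s. f (g s, h s))" if "continuous_on S g" "continuous_on S h"
    for S :: "'b::topological_space set" and g h
    by (intro continuous_on_flow[OF f] that)
  have pos: "f (t, x) \<noteq> x" if "t > 0" for t x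
    using flow_fixed_point_of_periodic_orbit[OF surf assms(3) f that] nofix by blast
  have noper: "f (t, x) \<noteq> x" if "t \<noteq> 0" for t x
  proof (cases "t > 0")
    case False
    then show ?thesis using pos[of "- t" x] that flow_add[OF f, of "- t" t x] f by auto
  qed (rule pos)

  \<comment> \<open>Any starting point would do.\<close>
  define x1 :: 'a where "x1 = undefined"
  \<comment> \<open>Integer times give a countable set, so \<omega>-boundedness yields a cluster
    point \<open>x0\<close>, near which the orbit of \<open>x1\<close> returns at arbitrarily late
    times.\<close>
  let ?F = "filtermap (\<lambda>n::nat. f (real n, x1)) sequentially"
  have "compact (closure (range (\<lambda>n::nat. f (real n, x1))))"
    using assms(2) unfolding omega_bounded_def by auto
  moreover have "eventually (\<lambda>x. x \<in> closure (range (\<lambda>n::nat. f (real n, x1)))) ?F"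
    by (auto simp: eventually_filtermap intro!: always_eventually subsetD[OF closure_subset])
  moreover have "?F \<noteq> bot" by (simp add: filtermap_bot_iff)
  ultimately obtain x0 where x0: "inf (nhds x0) ?F \<noteq> bot"
    unfolding compact_filter by blast
  have recur: "\<exists>n\<ge>N. f (real n, x1) \<in> G" if G: "open G" "x0 \<in> G" for G N
  proof (rule ccontr)
    assume "\<not> ?thesis"
    then have "eventually (\<lambda>x. x \<notin> G) ?F"
      unfolding eventually_filtermap eventually_sequentially by blast
    moreover have "eventually (\<lambda>x. x \<in> G) (nhds x0)" using G by (rule eventually_nhds_in_open)
    ultimately have "eventually (\<lambda>x. False) (inf (nhds x0) ?F)"
      unfolding eventually_inf by blast
    then show False using x0 by (simp add: eventually_False)
  qed

  \<comment> \<open>The chart avoids \<open>f (1, x0)\<close>, so an orbit starting near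
    \<open>x0\<close> is outside \<open>V\<close> at time 1; this provides the point of the circle
    that \<open>V\<close> omits.\<close>
  have "open (- {f (1, x0)})" "x0 \<in> - {f (1, x0)}" using noper[of 1 x0] by auto
  then obtain c :: "real^2" and R V \<psi> \<phi> where R: "0 < R" and hom: "homeomorphism (cball c R) V \<psi> \<phi>"
    and c: "\<psi> c = x0" and V: "f (1, x0) \<notin> V"
    using surface_chart[OF surf, of "- {f (1, x0)}" x0] by (metis ComplD insertI1 subsetD)
  have V_eq: "V = \<psi> ` cball c R" and cont\<psi>: "continuous_on (cball c R) \<psi>" and cont\<phi>: "continuous_on V \<phi>"
    using homeomorphism_image1[OF hom] homeomorphism_cont1[OF hom] homeomorphism_cont2[OF hom] by simp_all
  have compV: "compact V" using compact_continuous_image[OF cont\<psi>] V_eq by simp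
  have \<phi>\<psi>: "\<phi> (\<psi> z) = z" if "z \<in> cball c R" for z using homeomorphism_apply1[OF hom that] .
  have \<phi>_inj: "y = z" if "\<phi> y = \<phi> z" "y \<in> V" "z \<in> V" for y z
    using that homeomorphism_apply2[OF hom] by metis
  have open_ball: "open (\<psi> ` ball c \<rho>)" if "\<rho> \<le> R" for \<rho>
  proof -
    have "ball c \<rho> \<subseteq> cball c R" using that by auto
    then show ?thesis
      using \<phi>\<psi> by (intro surface_invariance_of_domain[OF surf] continuous_on_subset[OF cont\<psi>] inj_on_inverseI[where g = \<phi>]) auto
  qed
  have shrink: "\<exists>\<rho>>0. \<rho> \<le> R \<and> \<psi> ` cball c \<rho> \<subseteq> H" if H: "open H" "x0 \<in> H" for H
  proof -
    have "open (ball c R \<inter> \<psi> -` H)"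
      by (intro continuous_open_preimage continuous_on_subset[OF cont\<psi>] H) auto
    moreover have "c \<in> ball c R \<inter> \<psi> -` H" using R H c by simp
    ultimately obtain \<rho> where "\<rho> > 0" "cball c \<rho> \<subseteq> ball c R \<inter> \<psi> -` H"
      using open_contains_cball by meson
    then show ?thesis by (intro exI[of _ "min \<rho> R"]) (use R in auto)
  qed
  define B where "B = \<psi> ` ball c R"
  have B: "open B" "x0 \<in> B" "B \<subseteq> V" using open_ball[of R] R c V_eq by (auto simp: B_def)

  have "open ((\<lambda>t. f (t, x0)) -` B)"
    using B(1) cont[of UNIV "\<lambda>t. t" "\<lambda>_. x0"] by (simp add: continuous_on_open_vimage)
  moreover have "0 \<in> (\<lambda>t. f (t, x0)) -` B" using B f by simp
  ultimately obtain e where e: "e > 0" "ball 0 e \<subseteq> (\<lambda>t. f (t, x0)) -` B"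
    using open_contains_ball by meson
  define \<epsilon> where "\<epsilon> = min (e / 2) (1 / 2)"
  have \<epsilon>: "0 < \<epsilon>" "\<epsilon> < 1" "\<epsilon> < e" using e(1) by (auto simp: \<epsilon>_def)
  have in_B: "f (t, x0) \<in> B" if "t \<in> {-\<epsilon>..\<epsilon>}" for t
    using e(2) \<epsilon> that by (auto simp: subset_eq)
  have cont\<phi>f: "continuous_on S (\<lambda>t. \<phi> (f (g t, x0)))"
    if "continuous_on S g" "g ` S \<subseteq> {-\<epsilon>..\<epsilon>}" for S :: "real set" and g
    by (intro continuous_on_compose2[OF cont\<phi>] cont that continuous_intros) (use that(2) in_B B(3) in blast)
  have "continuous_on {-\<epsilon>..0} (\<lambda>t. dist (\<phi> (f (t, x0))) (\<phi> (f (t + \<epsilon>, x0))))"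
    by (intro continuous_on_dist cont\<phi>f continuous_intros) (use \<epsilon> in auto)
  then obtain t0 where t0: "t0 \<in> {-\<epsilon>..0}"
    "\<And>t. t \<in> {-\<epsilon>..0} \<Longrightarrow> dist (\<phi> (f (t0, x0))) (\<phi> (f (t0 + \<epsilon>, x0))) \<le> dist (\<phi> (f (t, x0))) (\<phi> (f (t + \<epsilon>, x0)))"
    using continuous_attains_inf[of "{-\<epsilon>..0}" "\<lambda>t. dist (\<phi> (f (t, x0))) (\<phi> (f (t + \<epsilon>, x0)))"] \<epsilon> by auto
  \<comment> \<open>A quarter of the least chart displacement over time \<open>\<epsilon>\<close>
    along the orbit of \<open>x0\<close>, for starting times in \<open>{-\<epsilon>..0}\<close>; it
    is positive because no point is periodic.\<close>
  define \<eta> where "\<eta> = dist (\<phi> (f (t0, x0))) (\<phi> (f (t0 + \<epsilon>, x0))) / 4"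
  have \<eta>: "\<eta> > 0"
  proof -
    have "f (t0, x0) \<in> V" "f (t0 + \<epsilon>, x0) \<in> V"
      using in_B[of t0] in_B[of "t0 + \<epsilon>"] t0(1) \<epsilon> B(3) by auto
    moreover have "f (t0, x0) \<noteq> f (t0 + \<epsilon>, x0)"
      using flow_eq_imp_period[OF f, of t0 x0 "t0 + \<epsilon>"] noper[of \<epsilon> x0] \<epsilon> by auto
    ultimately show ?thesis using \<phi>_inj unfolding \<eta>_def by auto
  qed
  have "uniformly_continuous_on {0..\<epsilon>} (\<lambda>t. \<phi> (f (t, x0)))"
    by (intro compact_uniformly_continuous cont\<phi>f continuous_intros) (use \<epsilon> in auto)
  then obtain d where d: "d > 0" "\<And>s t. s \<in> {0..\<epsilon>} \<Longrightarrow> t \<in> {0..\<epsilon>} \<Longrightarrow> dist s t < d \<Longrightarrow>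
      dist (\<phi> (f (s, x0))) (\<phi> (f (t, x0))) < \<eta>"
    using \<eta> unfolding uniformly_continuous_on_def by metis
  define \<tau> where "\<tau> = min (d / 2) (\<epsilon> / 2)"
  have \<tau>: "0 < \<tau>" "\<tau> < \<epsilon>" "\<tau> < d" using d(1) \<epsilon> by (auto simp: \<tau>_def)

  let ?g = "\<lambda>z :: 'a \<times> real. f (snd z, fst z)"
  have contg: "continuous_on S ?g" for S by (intro cont continuous_intros)
  have vim: "open (?g -` G)" if "open G" for G
    using that contg[of UNIV] by (simp add: continuous_on_open_vimage)
  \<comment> \<open>Compactness of the time intervals spreads properties of the orbit of
    \<open>x0\<close> to all nearby points: \<open>G1\<close> keeps short orbits in
    \<open>B\<close>, \<open>G2\<close> keeps them close to that of \<open>x0\<close>, and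
    \<open>G3\<close> excludes returns at times in \<open>{1..2}\<close>.\<close>
  obtain G1 where G1: "x0 \<in> G1" "open G1" "G1 \<times> {-\<epsilon>..\<epsilon>} \<subseteq> ?g -` B"
    using Elementary_Topology.tube_lemma[OF compact_Icc vim[OF B(1)], of x0 "-\<epsilon>" \<epsilon>] in_B by fastforce
  have "continuous_on (G1 \<times> {-\<epsilon>..\<epsilon>}) (\<lambda>z. \<phi> (?g z))"
    by (rule continuous_on_compose2[OF cont\<phi> contg]) (use G1(3) B(3) in blast)
  then obtain G2 where G2: "x0 \<in> G2" "open G2"
    "\<forall>w\<in>G2 \<inter> G1. \<forall>t\<in>{-\<epsilon>..\<epsilon>}. dist (\<phi> (?g (w, t))) (\<phi> (?g (x0, t))) \<le> \<eta> / 2"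
    using continuous_on_prod_compactE[of G1 "{-\<epsilon>..\<epsilon>}" "\<lambda>z. \<phi> (?g z)" x0 "\<eta> / 2"] G1(1) \<eta> by auto
  have "compact ((\<lambda>t. f (t, x0)) ` {1..2})"
    by (intro compact_continuous_image cont continuous_intros) auto
  then have "open (- (\<lambda>t. f (t, x0)) ` {1..2})" by (simp add: compact_imp_closed open_Compl)
  moreover have "x0 \<in> - (\<lambda>t. f (t, x0)) ` {1..2}"
  proof -
    have "x0 \<noteq> f (t, x0)" if "t \<in> {1..2}" for t using noper[of t x0] that by auto
    then show ?thesis by blast
  qed
  ultimately obtain \<rho>0 where \<rho>0: "\<rho>0 > 0" "\<rho>0 \<le> R" "\<psi> ` cball c \<rho>0 \<subseteq> - (\<lambda>t. f (t, x0)) ` {1..2}"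
    using shrink by blast
  have "compact (\<psi> ` cball c \<rho>0)"
    by (intro compact_continuous_image continuous_on_subset[OF cont\<psi>]) (use \<rho>0 in auto)
  then have "open (- \<psi> ` cball c \<rho>0)" by (simp add: compact_imp_closed open_Compl)
  then obtain G3 where G3: "x0 \<in> G3" "open G3" "G3 \<times> {1..2} \<subseteq> ?g -` (- \<psi> ` cball c \<rho>0)"
    using Elementary_Topology.tube_lemma[OF compact_Icc vim, of "- \<psi> ` cball c \<rho>0" x0 1 2] \<rho>0(3) by fastforce
  define G4 where "G4 = (\<lambda>w. f (1, w)) -` (- V)"
  have G4: "open G4" "x0 \<in> G4"
    using compV V cont[of UNIV "\<lambda>_. 1" "\<lambda>w. w"] by (auto simp: G4_def compact_imp_closed open_Compl continuous_on_open_vimage)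
  obtain \<rho>1 where \<rho>1: "\<rho>1 > 0" "\<rho>1 \<le> R" "\<psi> ` cball c \<rho>1 \<subseteq> G1 \<inter> G2 \<inter> G3 \<inter> G4"
    using shrink[of "G1 \<inter> G2 \<inter> G3 \<inter> G4"] G1 G2 G3 G4 by blast
  define \<rho> where "\<rho> = min \<rho>0 \<rho>1"
  have \<rho>: "0 < \<rho>" "\<rho> \<le> R" using \<rho>0 \<rho>1 by (auto simp: \<rho>_def)
  define W where "W = \<psi> ` ball c \<rho>"
  have WG: "W \<subseteq> G1 \<inter> G2 \<inter> G3 \<inter> G4" and W0: "W \<subseteq> \<psi> ` cball c \<rho>0"
    using \<rho>1(3) by (auto simp: W_def \<rho>_def)
  have W: "open W" "x0 \<in> W" using open_ball[OF \<rho>(2)] \<rho> c by (auto simp: W_def)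

  \<comment> \<open>Distinct integer times differ by at least 1, which is the gap that
    \<open>flow_closest_return\<close> asks for.\<close>
  obtain n1 where n1: "f (real n1, x1) \<in> W" using recur[OF W] by blast
  obtain n2 where n2: "n2 \<ge> n1 + 1" "f (real n2, x1) \<in> W" using recur[OF W] by blast
  have "f (real n2 - real n1, f (real n1, x1)) \<in> W" using n2 by (simp add: flow_add[OF f])
  moreover have "f (t, w) \<notin> W" if "t \<in> {1..2}" "w \<in> W" for t w
    using subsetD[OF G3(3), of "(w, t)"] WG W0 that by auto
  ultimately obtain p T where pT: "p \<in> W" "f (T, p) \<in> W" "1 \<le> T"
    "\<And>s. s \<in> {0..T} \<Longrightarrow> f (s, p) \<notin> \<psi> ` open_segment (\<phi> (f (T, p))) (\<phi> p)"
    using flow_closest_return[OF f hom W_def \<rho>(2) _ n1, of "real n2 - real n1"] n2(1)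
    by (metis of_nat_1 of_nat_add of_nat_le_iff add_le_imp_le_diff add.commute)
  have "\<exists>x. \<forall>t. f (t, x) = x"
  proof (rule flow_fixed_point_of_close_return[OF surf assms(3) f noper hom W_def \<rho> \<tau>(1,2) \<epsilon>(2) pT(3,1,2) _ pT(4)])
    show "f (1, p) \<notin> V" using pT(1) WG by (auto simp: G4_def)
    show "f (t, w) \<in> V \<and> dist (\<phi> (f (t, w))) (\<phi> (f (t, \<psi> c))) < \<eta>" if "w \<in> W" "t \<in> {-\<epsilon>..\<epsilon>}" for w t
    proof -
      have w: "w \<in> G1" "w \<in> G2 \<inter> G1" using that WG by auto
      then have "f (t, w) \<in> B" using G1(3) that(2) by fastforce
      moreover have "dist (\<phi> (f (t, w))) (\<phi> (f (t, x0))) \<le> \<eta> / 2"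
        using G2(3) w(2) that(2) by auto
      ultimately show ?thesis using B(3) \<eta> c by auto
    qed
    show "dist (\<phi> (f (s, \<psi> c))) (\<phi> (f (t, \<psi> c))) < \<eta>"
      if "s \<in> {0..\<epsilon>}" "t \<in> {0..\<epsilon>}" "\<bar>s - t\<bar> \<le> \<tau>" for s t
      using d(2)[OF that(1,2)] that(3) \<tau>(3) c by (simp add: dist_real_def)
    show "4 * \<eta> \<le> dist (\<phi> (f (t, \<psi> c))) (\<phi> (f (t + \<epsilon>, \<psi> c)))" if "t \<in> {-\<epsilon>..0}" for t
      using t0(2)[OF that] c by (simp add: \<eta>_def)
  qed
  then show False using nofix by blast
qed

end
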